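(* Let $r\ge 1$ be an integer. There exist infinitely many (pairwise non-isomorphic) cubic $2$-connected graphs $G$ which contain at least $2^r$ Šoltés vertices.
   Context: All graphs are finite, simple and undirected. For a connected graph $G$, the Wiener index is $W(G)=\sum_{\{u,v\}\subseteq V(G)} d_G(u,v)$, where $d_G(u,v)$ is the length of a shortest $u$–$v$ path; if $G$ is disconnected, $W(G)=\infty$. For $v\in V(G)$, $G-v$ denotes the graph obtained by deleting $v$. A vertex $v$ of $G$ is a Šoltés vertex of $G$ if $W(G-v)=W(G)$. *)

theory Defs
  imports
    "Graph_Theory.Digraph_Component"
    "Graph_Theory.Digraph_Isomorphism"
    "Graph_Theory.Shortest_Path"
begin

text \<open>
  A finite simple undirected graph is a symmetric loop-free finite digraph without parallel arcs
  (the locale \<^term>\<open>graph\<close>, or \<^term>\<open>pair_graph\<close> when the arcs are pairs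
  of vertices); an edge is represented by its two opposite arcs.  The degree of a vertex is
  therefore its out-degree.  The definitions below are meant for such graphs.
\<close>

definition cubic :: "('a, 'b) pre_digraph \<Rightarrow> bool" where
  "cubic G \<longleftrightarrow> (\<forall>v\<in>verts G. out_degree G v = 3)"

definition vertex_connected :: "nat \<Rightarrow> ('a, 'b) pre_digraph \<Rightarrow> bool" where
  "vertex_connected k G \<longleftrightarrow> k < card (verts G) \<and>
     (\<forall>X\<subseteq>verts G. card X < k \<longrightarrow> Digraph_Component.connected (G \<restriction> (verts G - X)))"

text \<open>
  The shortest-path distance of the library for unit arc weights, so that a walk costs its length.
\<close>

definition distance :: "('a, 'b) pre_digraph \<Rightarrow> 'a \<Rightarrow> 'a \<Rightarrow> ereal" where
  "distance G u v = wf_digraph.\<mu> G (\<lambda>_. 1) u v"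

text \<open>
  The sum in the Wiener index ranges over unordered pairs, i.e. two-element sets of vertices.
  As the distance is symmetric, it induces a function on these sets (see the lemma
  \<open>pair_distance_eq\<close> below).
\<close>

definition pair_distance :: "('a, 'b) pre_digraph \<Rightarrow> 'a set \<Rightarrow> ereal" where
  "pair_distance G e = (THE d. \<exists>u v. e = {u, v} \<and> d = distance G u v)"

definition wiener_index :: "('a, 'b) pre_digraph \<Rightarrow> ereal" where
  "wiener_index G =
     (if Digraph_Component.connected G
      then \<Sum>e\<in>{e. e \<subseteq> verts G \<and> card e = 2}. pair_distance G e
      else \<infinity>)"

definition soltes_vertex :: "('a, 'b) pre_digraph \<Rightarrow> 'a \<Rightarrow> bool" where
  "soltes_vertex G v \<longleftrightarrow>
     v \<in> verts G \<and> wiener_index (pre_digraph.del_vert G v) = wiener_index G"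

lemma (in wf_digraph) awalk_cost_unit: "awalk_cost (\<lambda>_. 1) p = real (length p)"
  by (induction p) auto

lemma (in fin_digraph) distance_shortest_path:
  assumes "u \<rightarrow>\<^sup>* v"
  shows "\<exists>p. apath u p v \<and> distance G u v = ereal (real (length p))
             \<and> (\<forall>q. apath u q v \<longrightarrow> length p \<le> length q)"
proof -
  obtain p where p: "apath u p v" "\<mu> (\<lambda>_. 1) u v = ereal (awalk_cost (\<lambda>_. 1) p)"
    using min_cost_awalk[OF assms, of "\<lambda>_. 1"] by auto
  have "length p \<le> length q" if "apath u q v" for q
  proof -
    have "\<mu> (\<lambda>_. 1) u v \<le> ereal (awalk_cost (\<lambda>_. 1) q)"
      using that by (intro min_cost_le_walk_cost) (auto simp: apath_def)
    then show ?thesis using p(2) by (simp add: awalk_cost_unit)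
  qed
  then show ?thesis using p by (auto simp: distance_def awalk_cost_unit)
qed

lemma (in sym_digraph) awalk_rev:
  assumes "awalk u p v"
  shows "\<exists>q. awalk v q u \<and> length q = length p"
  using assms
proof (induction p arbitrary: u)
  case Nil
  then show ?case by (auto simp: awalk_Nil_iff)
next
  case (Cons e p)
  then have e: "e \<in> arcs G" "tail G e = u" and p: "awalk (head G e) p v"
    by (auto simp: awalk_Cons_iff)
  obtain q where q: "awalk v q (head G e)" "length q = length p"
    using Cons.IH[OF p] by blast
  obtain e' where e': "e' \<in> arcs G" "tail G e' = head G e" "head G e' = u"
    using sym_arcs e unfolding symmetric_conv by metis
  have "awalk (head G e) [e'] u"
    using e' by (metis arc_implies_awalk)
  then have "awalk v (q @ [e']) u"
    using q(1) awalk_appendI by blast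
  then show ?case using q(2) by (intro exI[of _ "q @ [e']"]) simp
qed

lemma (in sym_digraph) distance_sym: "distance G u v = distance G v u"
proof -
  have "distance G v u \<le> distance G u v" for u v
    unfolding distance_def \<mu>_def
  proof (rule INF_mono)
    fix p assume "p \<in> {p. awalk u p v}"
    then obtain q where "awalk v q u" "length q = length p"
      using awalk_rev by blast
    then show "\<exists>q\<in>{p. awalk v p u}.
        ereal (awalk_cost (\<lambda>_. 1) q) \<le> ereal (awalk_cost (\<lambda>_. 1) p)"
      by (auto simp: awalk_cost_unit)
  qed
  then show ?thesis by (intro antisym)
qed

lemma (in sym_digraph) pair_distance_eq: "pair_distance G {u, v} = distance G u v"
  unfolding pair_distance_def
  by (rule the_equality) (auto simp: doubleton_eq_iff distance_sym)

end

theory Submission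
  imports Defs
begin

text \<open>
  If \<open>v\<close> is opposite to an edge \<open>st\<close> on a long closed chain, deleting \<open>v\<close> leaves
  all distances from \<open>s\<close> and \<open>t\<close> unchanged, but adds a cubic amount to the distances within
  the chain. Anything attached through \<open>s\<close> and \<open>t\<close> only contributes its distances to
  \<open>v\<close>, which lowers \<open>W(G - v) - W(G)\<close> by a sum depending only on the distances from
  \<open>{s, t}\<close>. This applies to a second copy of the same graph, joined so that the two copies can
  be exchanged; iterating doubles the number of equivalent vertices \<open>v\<close> at a merely quadratic
  cost. What is left of the cubic surplus is absorbed exactly by a tail that is long enough and has
  adjustable level sizes.
\<close>

section \<open>Distances in relations\<close>

text \<open>Equal distance a from v to \<open>s\<close> and \<open>t\<close> makes the cost of an
  attached vertex computable: at distance l from the edge it costs exactly a + l, whichever terminal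
  a shortest path uses. Hence the remaining surplus f is one number that each attachment lowers by a
  known sum, and all vertices of the set S share it. The invariant behind the construction is that
  for every K there is a gadget on n vertices with f at least K * n^2. Leaving K free pays in
  advance for each doubling, which costs at most (2 * n + 4)^2, and for the quadratic threshold
  above which a fitting tail exists. The obstacle to hitting f exactly is parity: layers of even
  size can only be rearranged in even amounts. Two caps with equally many vertices, whose level sums
  differ by one, settle it. Two-connectedness is carried along as an st-numbering. Its conditions
  concern a vertex and its neighbours only, so they can be checked on an attached piece
  alone.\<close>

definition gdist :: "'a rel \<Rightarrow> 'a \<Rightarrow> 'a \<Rightarrow> nat" where
  "gdist R x y = (LEAST k. (x, y) \<in> R ^^ k)"

definition del :: "'a rel \<Rightarrow> 'a \<Rightarrow> 'a rel" where
  "del R v = {(x, y) \<in> R. x \<noteq> v \<and> y \<noteq> v}"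

definition ordered_wiener :: "'a set \<Rightarrow> 'a rel \<Rightarrow> nat" where
  "ordered_wiener V R = (\<Sum>x\<in>V. \<Sum>y\<in>V. gdist R x y)"

definition simple_graph :: "'a set \<Rightarrow> 'a rel \<Rightarrow> bool" where
  "simple_graph V R \<longleftrightarrow> finite V \<and> R \<subseteq> V \<times> V \<and> sym R \<and> irrefl R"

lemma gdist_path: "(x, y) \<in> R\<^sup>* \<Longrightarrow> (x, y) \<in> R ^^ gdist R x y"
  unfolding gdist_def by (rule LeastI_ex) (simp add: rtrancl_power)

lemma gdist_le: "(x, y) \<in> R ^^ k \<Longrightarrow> gdist R x y \<le> k"
  unfolding gdist_def by (rule Least_le)

lemma gdist_self [simp]: "gdist R x x = 0"
  using gdist_le[where k = 0 and x = x and y = x and R = R] by simp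

lemma gdist_edge: "(x, y) \<in> R \<Longrightarrow> gdist R x y \<le> 1"
  using gdist_le[where k = 1 and x = x and y = y and R = R] by simp

lemma gdist_triangle:
  assumes "(x, y) \<in> R\<^sup>*" "(y, z) \<in> R\<^sup>*"
  shows "gdist R x z \<le> gdist R x y + gdist R y z"
  by (intro gdist_le) (metis assms gdist_path relcompI relpow_add)

lemma relpow_sym: "sym R \<Longrightarrow> (x, y) \<in> R ^^ k \<Longrightarrow> (y, x) \<in> R ^^ k"
proof (induction k arbitrary: y)
  case (Suc k)
  then obtain z where "(x, z) \<in> R ^^ k" "(z, y) \<in> R" by auto
  with Suc show ?case by (metis relpow_Suc_I2 symD)
qed auto

lemma gdist_commute: "sym R \<Longrightarrow> gdist R x y = gdist R y x"
  unfolding gdist_def by (metis relpow_sym)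

lemma rtrancl_commute: "sym R \<Longrightarrow> (x, y) \<in> R\<^sup>* \<Longrightarrow> (y, x) \<in> R\<^sup>*"
  by (metis symD sym_rtrancl)

lemma relpow_map:
  assumes "\<And>x y. (x, y) \<in> R \<Longrightarrow> h x = h y \<or> (h x, h y) \<in> R'" and "(x, y) \<in> R ^^ k"
  shows "\<exists>j\<le>k. (h x, h y) \<in> R' ^^ j"
  using assms(2)
proof (induction k arbitrary: y)
  case (Suc k)
  then obtain z where z: "(x, z) \<in> R ^^ k" "(z, y) \<in> R" by auto
  then obtain j where j: "j \<le> k" "(h x, h z) \<in> R' ^^ j" using Suc by blast
  show ?case
  proof (cases "h z = h y")
    case True then show ?thesis using j by (metis le_SucI)
  next
    case False
    then have "(h x, h y) \<in> R' ^^ Suc j" using assms(1) z(2) j(2) by auto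
    then show ?thesis using j(1) by (metis Suc_le_mono)
  qed
qed auto

lemma gdist_map_le:
  assumes "\<And>x y. (x, y) \<in> R \<Longrightarrow> h x = h y \<or> (h x, h y) \<in> R'" and "(x, y) \<in> R\<^sup>*"
  shows "gdist R' (h x) (h y) \<le> gdist R x y"
  using relpow_map[of R h R', OF assms(1) gdist_path[OF assms(2)]] gdist_le le_trans by metis

lemma gdist_antimono: "R \<subseteq> R' \<Longrightarrow> (x, y) \<in> R\<^sup>* \<Longrightarrow> gdist R' x y \<le> gdist R x y"
  using gdist_map_le[of R "\<lambda>x. x" R' x y] by auto

text \<open>Certificate for lower bounds on distances: a potential that falls by at most one per
  edge cannot fall faster than steps are taken. It is integer-valued because \<open>pos\<close>
  takes negative values.\<close>

lemma lipschitz_relpow: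
  fixes \<mu> :: "'a \<Rightarrow> int"
  assumes "\<And>x y. (x, y) \<in> R \<Longrightarrow> \<mu> x \<le> \<mu> y + 1" and "(x, y) \<in> R ^^ k"
  shows "\<mu> x \<le> \<mu> y + int k"
  using assms(2)
proof (induction k arbitrary: y)
  case (Suc k)
  then obtain z where z: "(x, z) \<in> R ^^ k" "(z, y) \<in> R" by auto
  show ?case using Suc.IH[OF z(1)] assms(1)[OF z(2)] by simp
qed auto

lemma lipschitz_gdist:
  fixes \<mu> :: "'a \<Rightarrow> int"
  assumes "\<And>x y. (x, y) \<in> R \<Longrightarrow> \<mu> x \<le> \<mu> y + 1" and "(x, y) \<in> R\<^sup>*"
  shows "\<mu> x \<le> \<mu> y + int (gdist R x y)"
  using lipschitz_relpow[of R \<mu>, OF assms(1) gdist_path[OF assms(2)]] .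

text \<open>Certificate for upper bounds on distances, the counterpart of
  \<open>lipschitz_relpow\<close>. The set \<open>U\<close> confines the descent, for instance to
  one side of a deleted vertex.\<close>

lemma descent:
  fixes \<mu> :: "'a \<Rightarrow> nat"
  assumes "\<And>x. x \<in> U \<Longrightarrow> x \<notin> T \<Longrightarrow> \<exists>y\<in>U. (x, y) \<in> R \<and> \<mu> y < \<mu> x" and "x \<in> U"
  shows "\<exists>t\<in>T \<inter> U. \<exists>k\<le>\<mu> x. (x, t) \<in> R ^^ k"
  using assms(2)
proof (induction "\<mu> x" arbitrary: x rule: less_induct)
  case less
  show ?case
  proof (cases "x \<in> T")
    case True then show ?thesis using less.prems by (intro bexI[of _ x] exI[of _ 0]) auto
  next
    case False
    then obtain y where y: "y \<in> U" "(x, y) \<in> R" "\<mu> y < \<mu> x" using assms(1) less.prems by blast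
    then obtain t k where "t \<in> T \<inter> U" "k \<le> \<mu> y" "(y, t) \<in> R ^^ k" using less.hyps by blast
    then have "(x, t) \<in> R ^^ Suc k" "Suc k \<le> \<mu> x" using y relpow_Suc_I2 by fastforce+
    then show ?thesis using \<open>t \<in> T \<inter> U\<close> by blast
  qed
qed

lemma descent_gdist:
  fixes \<mu> :: "'a \<Rightarrow> nat"
  assumes "\<And>x. x \<in> U \<Longrightarrow> x \<noteq> t \<Longrightarrow> \<exists>y\<in>U. (x, y) \<in> R \<and> \<mu> y < \<mu> x" and "x \<in> U"
  shows "(x, t) \<in> R\<^sup>*" "gdist R x t \<le> \<mu> x"
proof -
  obtain k where "k \<le> \<mu> x" "(x, t) \<in> R ^^ k"
    using descent[of U "{t}" R \<mu> x] assms by auto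
  then show "(x, t) \<in> R\<^sup>*" "gdist R x t \<le> \<mu> x"
    using gdist_le le_trans relpow_imp_rtrancl by metis+
qed

text \<open>A shortest path contains a vertex at each distance 0, ..., \<open>gdist R x y\<close>
  from x, and these vertices are distinct.\<close>

lemma gdist_bound:
  assumes "finite V" "R \<subseteq> V \<times> V" "(x, y) \<in> R\<^sup>*" "x \<in> V"
  shows "gdist R x y < card V"
proof -
  define D where "D i = {z \<in> V. (x, z) \<in> R\<^sup>* \<and> gdist R x z = i}" for i
  have hit: "\<exists>z\<in>V. (x, z) \<in> R\<^sup>* \<and> gdist R x z = i" if "i \<le> gdist R x y" for i
  proof -
    have "(x, y) \<in> R ^^ (i + (gdist R x y - i))" using gdist_path[OF assms(3)] that by simp
    then obtain z where z: "(x, z) \<in> R ^^ i" "(z, y) \<in> R ^^ (gdist R x y - i)"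
      unfolding relpow_add by blast
    have "z \<in> V" using z(1) assms by (cases i) auto
    moreover have r: "(x, z) \<in> R\<^sup>*" "(z, y) \<in> R\<^sup>*" using z relpow_imp_rtrancl by metis+
    moreover have "gdist R x z \<le> i" "gdist R z y \<le> gdist R x y - i"
      using gdist_le z by metis+
    ultimately show ?thesis using gdist_triangle[OF r] that by (intro bexI[of _ z]) auto
  qed
  have "{..gdist R x y} \<subseteq> gdist R x ` V" using hit by auto
  from surj_card_le[OF assms(1) this] show ?thesis by simp
qed

lemma sym_del: "sym R \<Longrightarrow> sym (del R v)"
  unfolding sym_def del_def by auto

lemma del_subset: "del R v \<subseteq> R"
  unfolding del_def by auto

lemma gdist_automorphism:
  assumes "\<And>x y. (x, y) \<in> R \<Longrightarrow> (\<sigma> x, \<sigma> y) \<in> R'" "\<And>x y. (x, y) \<in> R' \<Longrightarrow> (\<sigma> x, \<sigma> y) \<in> R"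
    and "\<And>x. \<sigma> (\<sigma> x) = x"
  shows "gdist R' (\<sigma> x) (\<sigma> y) = gdist R x y"
proof -
  have *: "(\<sigma> x, \<sigma> y) \<in> R' ^^ k" if "\<And>x y. (x, y) \<in> R \<Longrightarrow> (\<sigma> x, \<sigma> y) \<in> R'" "(x, y) \<in> R ^^ k"
    for R R' x y k
    using that(2) by (induction k arbitrary: y) (use that(1) in \<open>auto intro: relcompI\<close>)
  have "(\<sigma> x, \<sigma> y) \<in> R' ^^ k \<longleftrightarrow> (x, y) \<in> R ^^ k" for k
    using *[of R R' x y k] *[of R' R "\<sigma> x" "\<sigma> y" k] assms by auto
  then show ?thesis by (simp add: gdist_def)
qed

lemma ordered_wiener_automorphism:
  assumes "\<And>x y. (x, y) \<in> R \<Longrightarrow> (\<sigma> x, \<sigma> y) \<in> R'" "\<And>x y. (x, y) \<in> R' \<Longrightarrow> (\<sigma> x, \<sigma> y) \<in> R"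
    and "\<And>x. \<sigma> (\<sigma> x) = x" and "V' = \<sigma> ` V"
  shows "ordered_wiener V' R' = ordered_wiener V R"
proof -
  have inj: "inj_on \<sigma> V" using assms(3) by (metis inj_on_inverseI)
  show ?thesis unfolding ordered_wiener_def assms(4)
    by (simp add: sum.reindex[OF inj] gdist_automorphism[of R \<sigma> R', OF assms(1-3)])
qed

lemma ordered_wiener_unordered:
  fixes V :: "nat set"
  assumes "finite V" "sym R"
  shows "ordered_wiener V R = 2 * (\<Sum>(x, y)\<in>{(x, y) \<in> V \<times> V. x < y}. gdist R x y)"
proof -
  let ?f = "\<lambda>(x, y). gdist R x y"
  let ?L = "{(x, y) \<in> V \<times> V. x < y}" and ?G = "{(x, y) \<in> V \<times> V. y < x}"
    and ?E = "{(x, y) \<in> V \<times> V. x = y}"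
  have fin: "finite ?L" "finite ?G" "finite ?E"
    by (rule finite_subset[of _ "V \<times> V"]; use assms in auto)+
  have "ordered_wiener V R = sum ?f (V \<times> V)"
    unfolding ordered_wiener_def by (rule sum.cartesian_product)
  also have "V \<times> V = (?L \<union> ?G) \<union> ?E" by auto
  also have "sum ?f \<dots> = sum ?f (?L \<union> ?G) + sum ?f ?E"
    by (rule sum.union_disjoint) (use fin in auto)
  also have "sum ?f ?E = 0" by (rule sum.neutral) auto
  also have "sum ?f (?L \<union> ?G) = sum ?f ?L + sum ?f ?G"
    by (rule sum.union_disjoint) (use fin in auto)
  also have "sum ?f ?G = sum ?f ?L"
    by (rule sum.reindex_bij_witness[of _ prod.swap prod.swap])
       (auto simp: gdist_commute[OF assms(2)])
  finally show ?thesis by simp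
qed

section \<open>Attaching a graph at an edge\<close>

text \<open>This is an st-numbering in which ties are allowed: \<open>s\<close> is the only vertex
  without a lower neighbour and \<open>t\<close> the only one without a higher neighbour. It
  certifies that no single vertex separates the graph.\<close>

definition st_graph :: "'a set \<Rightarrow> 'a rel \<Rightarrow> 'a \<Rightarrow> 'a \<Rightarrow> bool" where
  "st_graph V R s t \<longleftrightarrow> simple_graph V R \<and> s \<in> V \<and> t \<in> V \<and> (s, t) \<in> R \<and>
     (\<exists>\<nu>::'a \<Rightarrow> nat. (\<forall>x\<in>V - {s}. \<exists>y. (x, y) \<in> R \<and> \<nu> y < \<nu> x) \<and>
                   (\<forall>x\<in>V - {t}. \<exists>y. (x, y) \<in> R \<and> \<nu> x < \<nu> y))"

text \<open>Vertices labelled at most \<open>\<nu> v\<close> descend to \<open>s\<close> and the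
  others ascend to \<open>t\<close>; strict monotonicity keeps both walks away from v. The edge
  between \<open>s\<close> and \<open>t\<close> joins the two parts if both ends survive.\<close>

lemma st_graph_del_reaches:
  assumes "st_graph V R s t" "x \<in> V - {v}" "y \<in> V - {v}"
  shows "(x, y) \<in> (del R v)\<^sup>*"
proof -
  obtain \<nu> :: "'a \<Rightarrow> nat" where \<nu>: "\<And>x. x \<in> V \<Longrightarrow> x \<noteq> s \<Longrightarrow> \<exists>y. (x, y) \<in> R \<and> \<nu> y < \<nu> x"
      "\<And>x. x \<in> V \<Longrightarrow> x \<noteq> t \<Longrightarrow> \<exists>y. (x, y) \<in> R \<and> \<nu> x < \<nu> y"
    using assms(1) unfolding st_graph_def by (metis DiffI singletonD)
  have V: "finite V" "R \<subseteq> V \<times> V" "sym R" "irrefl R" "(s, t) \<in> R"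
    using assms(1) unfolding st_graph_def simple_graph_def by auto
  define M where "M = Max (\<nu> ` V)"
  have M: "\<nu> z \<le> M" if "z \<in> V" for z using that V(1) by (auto simp: M_def)
  \<comment> \<open>Each disjunct records that the end in question is not v. If v is
    \<open>s\<close>, no other vertex can descend, so everything reaches \<open>t\<close>; the case
    of \<open>t\<close> is symmetric.\<close>
  have reach: "(s \<noteq> v \<and> (z, s) \<in> (del R v)\<^sup>*) \<or> (t \<noteq> v \<and> (z, t) \<in> (del R v)\<^sup>*)"
    if z: "z \<in> V - {v}" for z
  proof (cases "\<nu> z \<le> \<nu> v")
    case True
    let ?U = "{z \<in> V - {v}. \<nu> z \<le> \<nu> v}"
    have "\<exists>w\<in>?U. (u, w) \<in> del R v \<and> \<nu> w < \<nu> u" if u: "u \<in> ?U" "u \<notin> {s}" for u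
    proof -
      obtain w where "(u, w) \<in> R" "\<nu> w < \<nu> u" using u \<nu>(1) by auto
      then show ?thesis using u V(2) by (intro bexI[of _ w]) (auto simp: del_def)
    qed
    from descent[of ?U "{s}" "del R v" \<nu>, OF this] z True show ?thesis
      by (auto intro: relpow_imp_rtrancl)
  next
    case False
    let ?U = "{z \<in> V - {v}. \<nu> v \<le> \<nu> z}"
    have "\<exists>w\<in>?U. (u, w) \<in> del R v \<and> M - \<nu> w < M - \<nu> u" if u: "u \<in> ?U" "u \<notin> {t}" for u
    proof -
      obtain w where w: "(u, w) \<in> R" "\<nu> u < \<nu> w" using u \<nu>(2) by auto
      then have "w \<in> V" using V(2) by auto
      then show ?thesis using u w M[of w] by (intro bexI[of _ w]) (auto simp: del_def)
    qed
    moreover have "z \<in> ?U" using z False by simp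
    ultimately have "\<exists>u\<in>{t} \<inter> ?U. \<exists>k\<le>M - \<nu> z. (z, u) \<in> del R v ^^ k"
      by (rule descent[of ?U "{t}" "del R v" "\<lambda>z. M - \<nu> z"])
    then show ?thesis by (auto intro: relpow_imp_rtrancl)
  qed
  have st: "(s, t) \<in> (del R v)\<^sup>*" "(t, s) \<in> (del R v)\<^sup>*" if "s \<noteq> v" "t \<noteq> v"
    using that V by (auto simp: del_def sym_def intro!: r_into_rtrancl)
  have sym: "(z, w) \<in> (del R v)\<^sup>*" if "(w, z) \<in> (del R v)\<^sup>*" for z w
    using rtrancl_commute[OF sym_del[OF V(3)] that] .
  show ?thesis using reach[OF assms(2)] reach[OF assms(3)] st sym by (meson rtrancl_trans)
qed

lemma st_graph_reaches:
  assumes "st_graph V R s t" "x \<in> V" "y \<in> V"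
  shows "(x, y) \<in> R\<^sup>*"
proof -
  obtain \<nu> :: "'a \<Rightarrow> nat" where \<nu>: "\<And>x. x \<in> V \<Longrightarrow> x \<noteq> s \<Longrightarrow> \<exists>y. (x, y) \<in> R \<and> \<nu> y < \<nu> x"
    using assms(1) unfolding st_graph_def by (metis DiffI singletonD)
  have V: "R \<subseteq> V \<times> V" "sym R"
    using assms(1) unfolding st_graph_def simple_graph_def by auto
  have "(z, s) \<in> R\<^sup>*" if "z \<in> V" for z
    using descent_gdist(1)[of V s R \<nu> z] \<nu> V(1) that by blast
  then show ?thesis using assms(2,3) rtrancl_commute[OF V(2)] rtrancl_trans by metis
qed

text \<open>The factor \<open>2\<close> is due to \<^const>\<open>ordered_wiener\<close> counting every pair twice.\<close>

definition excess :: "'a set \<Rightarrow> 'a rel \<Rightarrow> 'a \<Rightarrow> 'a \<Rightarrow> 'a \<Rightarrow> nat \<Rightarrow> nat \<Rightarrow> bool" where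
  "excess V R v s t a f \<longleftrightarrow> v \<in> V - {s, t} \<and> gdist R v s = a \<and> gdist R v t = a \<and>
     (\<forall>y\<in>V - {v}. gdist (del R v) y s = gdist R y s \<and> gdist (del R v) y t = gdist R y t) \<and>
     ordered_wiener (V - {v}) (del R v) = ordered_wiener V R + 2 * f"

text \<open>The last two conditions certify that, outside \<open>V\<close>, \<open>lev\<close> is
  the distance to \<open>{s, t}\<close>: the Lipschitz condition gives one inequality and the
  descending neighbours the other. Stated edge by edge, they can be verified on a finite
  piece.\<close>

definition extends :: "'a set \<Rightarrow> 'a rel \<Rightarrow> 'a \<Rightarrow> 'a \<Rightarrow> 'a set \<Rightarrow> 'a rel \<Rightarrow> ('a \<Rightarrow> nat) \<Rightarrow> bool" where
  "extends V R s t V' R' lev \<longleftrightarrow> V \<subseteq> V' \<and> R = R' \<inter> V \<times> V \<and>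
     (\<forall>x\<in>V. \<forall>y. (x, y) \<in> R' \<longrightarrow> y \<notin> V \<longrightarrow> x = s \<or> x = t) \<and>
     (\<forall>x\<in>V. lev x = 0) \<and> (\<forall>(x, y)\<in>R'. lev x \<le> lev y + 1) \<and>
     (\<forall>x\<in>V' - V. \<exists>y. (x, y) \<in> R' \<and> lev y < lev x)"

text \<open>
  Collapsing everything outside
  \<open>B\<close> to \<open>s\<close>, or everything in \<open>B\<close> other than \<open>t\<close> to \<open>s\<close>, maps edges to
  edges or to single vertices, so both parts are isometric subgraphs.
\<close>

locale attached =
  fixes B V :: "'a set" and R RB :: "'a rel" and s t :: 'a
  assumes BV: "B \<subseteq> V" and RV: "R \<subseteq> V \<times> V" and symR: "sym R" and RB: "RB = R \<inter> B \<times> B"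
    and cross: "\<And>x y. (x, y) \<in> R \<Longrightarrow> x \<in> B \<Longrightarrow> y \<notin> B \<Longrightarrow> x = s \<or> x = t"
    and stB: "s \<in> B" "t \<in> B" and st: "(s, t) \<in> R"
    and conn: "\<And>x y. x \<in> V \<Longrightarrow> y \<in> V \<Longrightarrow> (x, y) \<in> R\<^sup>*"
    and connB: "\<And>x y. x \<in> B \<Longrightarrow> y \<in> B \<Longrightarrow> (x, y) \<in> RB\<^sup>*"
begin

lemma cross': "(x, y) \<in> R \<Longrightarrow> x \<notin> B \<Longrightarrow> y \<in> B \<Longrightarrow> y = s \<or> y = t"
  using cross symR by (meson symD)

lemma gdist_inner:
  assumes "x \<in> B" "y \<in> B"
  shows "gdist RB x y = gdist R x y"
proof (rule antisym)
  let ?h = "\<lambda>x. if x \<in> B then x else s"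
  have "?h x = ?h y \<or> (?h x, ?h y) \<in> RB" if "(x, y) \<in> R" for x y
    using that cross[of x y] cross'[of x y] stB st symD[OF symR st] unfolding RB by auto
  from gdist_map_le[of R ?h RB x y, OF this] assms BV conn show "gdist RB x y \<le> gdist R x y"
    by auto
  show "gdist R x y \<le> gdist RB x y"
    using gdist_antimono[of RB R] assms connB unfolding RB by auto
qed

text \<open>Cut a shortest path where it first enters \<open>B\<close>; by \<open>cross'\<close>
  this happens at \<open>s\<close> or \<open>t\<close>.\<close>

lemma through_terminal:
  assumes "x \<in> V - B" "y \<in> B"
  shows "\<exists>b\<in>{s, t}. gdist R x y = gdist R x b + gdist R b y"
proof -
  have "\<exists>b\<in>{s, t}. \<exists>i j. i + j = k \<and> (x, b) \<in> R ^^ i \<and> (b, y) \<in> R ^^ j"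
    if "(x, y) \<in> R ^^ k" "x \<notin> B" for k x
    using that
  proof (induction k arbitrary: x)
    case 0 then show ?case using assms by auto
  next
    case (Suc k)
    then obtain z where z: "(x, z) \<in> R" "(z, y) \<in> R ^^ k" by (metis relpow_Suc_D2)
    show ?case
    proof (cases "z \<in> B")
      case True
      then have "z \<in> {s, t}" using cross' z(1) Suc.prems by auto
      then show ?thesis using z by (intro bexI[of _ z] exI[of _ 1] exI[of _ k]) auto
    next
      case False
      then obtain b i j where b: "b \<in> {s, t}" "i + j = k" "(z, b) \<in> R ^^ i" "(b, y) \<in> R ^^ j"
        using Suc.IH z(2) by blast
      then have "(x, b) \<in> R ^^ Suc i" using z(1) by (metis relpow_Suc_I2)
      then show ?thesis using b by (metis add_Suc)
    qed
  qed
  moreover have "(x, y) \<in> R ^^ gdist R x y"     by (intro gdist_path conn) (use assms BV in auto)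
  ultimately obtain b i j where b: "b \<in> {s, t}" "i + j = gdist R x y" "(x, b) \<in> R ^^ i"
      "(b, y) \<in> R ^^ j" using assms by blast
  have "gdist R x b + gdist R b y \<le> gdist R x y" using b gdist_le add_mono by metis
  moreover have "gdist R x y \<le> gdist R x b + gdist R b y"
    by (rule gdist_triangle) (use b relpow_imp_rtrancl in metis)+
  ultimately show ?thesis using b(1) by (metis antisym)
qed

lemma gdist_outer_del:
  assumes "x \<in> (V - B) \<union> {s, t}" "y \<in> (V - B) \<union> {s, t}" "v \<in> B - {s, t}"
    and "(x, y) \<in> (del R v)\<^sup>*"
  shows "gdist (del R v) x y = gdist R x y"
proof (rule antisym)
  \<comment> \<open>The image of this map avoids v, since \<open>B\<close> is collapsed onto the
    edge between \<open>s\<close> and \<open>t\<close>.\<close>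
  let ?h = "\<lambda>x. if x \<in> B \<and> x \<noteq> t then s else x"
  have "?h x = ?h y \<or> (?h x, ?h y) \<in> del R v" if "(x, y) \<in> R" for x y
    using that cross[of x y] cross'[of x y] stB st symD[OF symR st] assms(3)
    unfolding del_def by auto
  moreover have "(x, y) \<in> R\<^sup>*" using assms(1-2) BV conn stB by blast
  moreover have "?h x = x" "?h y = y" using assms(1-2) by auto
  ultimately show "gdist (del R v) x y \<le> gdist R x y" using gdist_map_le[of R ?h "del R v" x y]
    by simp
  show "gdist R x y \<le> gdist (del R v) x y"
    using gdist_antimono[OF del_subset assms(4)] .
qed

end


lemma sum_split: "finite V \<Longrightarrow> B \<subseteq> V \<Longrightarrow> sum f V = sum f B + (sum f (V - B) :: nat)"
  by (metis sum.subset_diff add.commute)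

text \<open>Paths between old and new vertices pass through \<open>s\<close> or \<open>t\<close>. As
  v is equally far from both, its distance to a new vertex is a plus the level; any other pair with
  a new vertex keeps its distance because distances to \<open>s\<close> and \<open>t\<close> survive
  the deletion. So the surplus falls exactly by the distances from v to the new vertices.\<close>

lemma
  assumes B: "st_graph B RB s t" and V: "st_graph V R s' t'"
    and ext: "extends B RB s t V R lev"
    and exc: "excess B RB v s t a (f + (\<Sum>x\<in>V - B. a + lev x))"
  shows extends_gdist: "\<And>x. x \<in> V - B \<Longrightarrow> gdist R v x = a + lev x"
    and extends_del_gdist: "\<And>x y. x \<in> V - B \<Longrightarrow> y \<in> V - {v} \<Longrightarrow> gdist (del R v) y x = gdist R y x"
    and extends_wiener: "ordered_wiener (V - {v}) (del R v) = ordered_wiener V R + 2 * f"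
proof -
  have BV: "B \<subseteq> V" and RB: "RB = R \<inter> B \<times> B"
    and cross: "\<And>x y. (x, y) \<in> R \<Longrightarrow> x \<in> B \<Longrightarrow> y \<notin> B \<Longrightarrow> x = s \<or> x = t"
    and lev0: "\<And>x. x \<in> B \<Longrightarrow> lev x = 0" and lip: "\<And>x y. (x, y) \<in> R \<Longrightarrow> lev x \<le> lev y + 1"
    and down: "\<And>x. x \<in> V - B \<Longrightarrow> \<exists>y. (x, y) \<in> R \<and> lev y < lev x"
    using ext unfolding extends_def by auto
  have fin: "finite V" and RV: "R \<subseteq> V \<times> V" and sym: "sym R"
    using V unfolding st_graph_def simple_graph_def by auto
  have stB: "s \<in> B" "t \<in> B" and st: "(s, t) \<in> R"
    using B RB unfolding st_graph_def by auto
  have v: "v \<in> B" "v \<noteq> s" "v \<noteq> t" and vs: "gdist RB v s = a" "gdist RB v t = a"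
    and keepB: "\<And>y. y \<in> B - {v} \<Longrightarrow> gdist (del RB v) y s = gdist RB y s"
      "\<And>y. y \<in> B - {v} \<Longrightarrow> gdist (del RB v) y t = gdist RB y t"
    and WB: "ordered_wiener (B - {v}) (del RB v)
      = ordered_wiener B RB + 2 * (f + (\<Sum>x\<in>V - B. a + lev x))"
    using exc unfolding excess_def by auto
  interpret G: attached B V R RB s t
    using BV RV sym RB cross stB st st_graph_reaches[OF V] st_graph_reaches[OF B]
    by unfold_locales
  interpret D: attached "B - {v}" "V - {v}" "del R v" "del RB v" s t
  proof
    show "\<And>x y. (x, y) \<in> del R v \<Longrightarrow> x \<in> B - {v} \<Longrightarrow> y \<notin> B - {v} \<Longrightarrow> x = s \<or> x = t"
      using cross unfolding del_def by auto
  qed (use BV RV sym_del[OF sym] RB stB st v st_graph_del_reaches[OF V] st_graph_del_reaches[OF B]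
      in \<open>auto simp: del_def\<close>)
  have inV: "s \<in> V" "t \<in> V" "v \<in> V" using stB v BV by auto
  have reach: "(x, y) \<in> R\<^sup>*" if "x \<in> V" "y \<in> V" for x y
    using st_graph_reaches[OF V that] .
  have reach': "(x, y) \<in> (del R v)\<^sup>*" if "x \<in> V" "x \<noteq> v" "y \<in> V" "y \<noteq> v" for x y
    using st_graph_del_reaches[OF V, of x v y] that by auto
  let ?d = "gdist R" and ?d' = "gdist (del R v)"
  have comm: "?d x y = ?d y x" "?d' x y = ?d' y x" for x y
    using gdist_commute sym sym_del by metis+
  have outer: "?d' x y = ?d x y" if "x \<in> (V - B) \<union> {s, t}" "y \<in> (V - B) \<union> {s, t}" for x y
    by (rule G.gdist_outer_del[OF that]) (use that v inV in \<open>auto intro!: reach'\<close>)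
  show keep: "?d' y x = ?d y x" if x: "x \<in> V - B" and y: "y \<in> V - {v}" for x y
  proof (cases "y \<in> B")
    case False then show ?thesis using outer x y by auto
  next
    case True
    \<comment> \<open>Both halves of the shortest path through b keep their length without v, so the
      deleted graph has an equally short route.\<close>
    obtain b where b: "b \<in> {s, t}" "?d x y = ?d x b + ?d b y"
      using G.through_terminal[OF x True] by blast
    have "?d' b y = ?d b y"
      using keepB[of y] b(1) y True D.gdist_inner[of y b] G.gdist_inner[of y b] stB v
        comm(1)[of y b] comm(2)[of y b] by auto
    moreover have "?d' x b = ?d x b" using outer x b by auto
    moreover have "?d' x y \<le> ?d' x b + ?d' b y"
      by (intro gdist_triangle reach') (use b(1) x y v inV in auto)
    moreover have "?d x y \<le> ?d' x y"
      by (intro gdist_antimono[OF del_subset] reach') (use x y v in auto)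
    ultimately show ?thesis using b(2) comm(1)[of x y] comm(2)[of x y] by simp
  qed
  show dist: "?d v x = a + lev x" if x: "x \<in> V - B" for x
  proof (rule antisym)
    have a: "?d b v = a" if "b \<in> {s, t}" for b
      using that vs G.gdist_inner[of v b] v stB comm(1)[of v b] by auto
    have step: "\<exists>y\<in>(V - B) \<union> {s, t}. (u, y) \<in> R \<and> lev y < lev u"
      if u: "u \<in> (V - B) \<union> {s, t}" "u \<notin> {s, t}" for u
    proof -
      obtain y where "(u, y) \<in> R" "lev y < lev u" using u down[of u] by auto
      then show ?thesis using G.cross'[of u y] u RV by (intro bexI[of _ y]) auto
    qed
    obtain b k where b: "b \<in> {s, t}" "k \<le> lev x" "(x, b) \<in> R ^^ k"
      using descent[of "(V - B) \<union> {s, t}" "{s, t}" R lev, OF step] x by blast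
    have "?d x v \<le> ?d x b + ?d b v"
      by (intro gdist_triangle reach) (use x b(1) inV in auto)
    then show "?d v x \<le> a + lev x"
      using a[OF b(1)] gdist_le[OF b(3)] b(2) comm(1)[of x v] by simp
    obtain c where c: "c \<in> {s, t}" "?d x v = ?d x c + ?d c v"
      using G.through_terminal[OF x v(1)] by blast
    have "int (lev x) \<le> int (lev c) + int (?d x c)"
      by (rule lipschitz_gdist[of R "\<lambda>x. int (lev x)"])
         (use lip x c(1) inV in \<open>fastforce, auto intro!: reach\<close>)
    then show "a + lev x \<le> ?d v x" using c a[OF c(1)] lev0[of c] stB comm[of x v] by auto
  qed
  let ?X = "V - B" and ?C = "B - {v}"
  have X: "V - {v} - ?C = ?X" using v BV by auto
  have finB: "finite B" using fin BV finite_subset by blast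
  have "ordered_wiener V R = (\<Sum>x\<in>B. (\<Sum>y\<in>B. ?d x y) + (\<Sum>y\<in>?X. ?d x y))
      + (\<Sum>x\<in>?X. (\<Sum>y\<in>B. ?d x y) + (\<Sum>y\<in>?X. ?d x y))"
    unfolding ordered_wiener_def by (simp add: sum_split[OF fin BV])
  also have "\<dots> = ordered_wiener B RB + (\<Sum>x\<in>B. \<Sum>y\<in>?X. ?d x y)
      + (\<Sum>x\<in>?X. \<Sum>y\<in>B. ?d x y) + (\<Sum>x\<in>?X. \<Sum>y\<in>?X. ?d x y)"
    unfolding ordered_wiener_def by (simp add: sum.distrib G.gdist_inner)
  \<comment> \<open>Of the two mixed blocks the deletion removes only the row and the column of v,
    and each of them sums to that of a + \<open>lev\<close>.\<close>
  also have "(\<Sum>x\<in>B. \<Sum>y\<in>?X. ?d x y) = (\<Sum>x\<in>?C. \<Sum>y\<in>?X. ?d x y) + (\<Sum>y\<in>?X. ?d v y)"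
    using sum.remove[OF finB v(1), of "\<lambda>x. \<Sum>y\<in>?X. ?d x y"] by simp
  also have "(\<Sum>x\<in>?X. \<Sum>y\<in>B. ?d x y) = (\<Sum>x\<in>?X. \<Sum>y\<in>?C. ?d x y) + (\<Sum>x\<in>?X. ?d v x)"
    by (simp add: sum.remove[OF finB v(1)] sum.distrib comm(1)[of _ v])
  also have "(\<Sum>x\<in>?X. ?d v x) = (\<Sum>x\<in>?X. a + lev x)" using dist by simp
  finally have 1: "ordered_wiener V R = ordered_wiener B RB + 2 * (\<Sum>x\<in>?X. a + lev x)
      + (\<Sum>x\<in>?C. \<Sum>y\<in>?X. ?d x y) + (\<Sum>x\<in>?X. \<Sum>y\<in>?C. ?d x y) + (\<Sum>x\<in>?X. \<Sum>y\<in>?X. ?d x y)"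
    by simp
  have CV: "?C \<subseteq> V - {v}" and finv: "finite (V - {v})" using BV fin by auto
  have "ordered_wiener (V - {v}) (del R v) = (\<Sum>x\<in>?C. (\<Sum>y\<in>?C. ?d' x y) + (\<Sum>y\<in>?X. ?d' x y))
      + (\<Sum>x\<in>?X. (\<Sum>y\<in>?C. ?d' x y) + (\<Sum>y\<in>?X. ?d' x y))"
    unfolding ordered_wiener_def using sum_split[OF finv CV, unfolded X] by simp
  also have "\<dots> = ordered_wiener ?C (del RB v) + (\<Sum>x\<in>?C. \<Sum>y\<in>?X. ?d' x y)
      + (\<Sum>x\<in>?X. \<Sum>y\<in>?C. ?d' x y) + (\<Sum>x\<in>?X. \<Sum>y\<in>?X. ?d' x y)"
    unfolding ordered_wiener_def by (simp add: sum.distrib D.gdist_inner)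
  also have "(\<Sum>x\<in>?C. \<Sum>y\<in>?X. ?d' x y) = (\<Sum>x\<in>?C. \<Sum>y\<in>?X. ?d x y)"
    by (intro sum.cong refl keep) (use BV in auto)
  also have "(\<Sum>x\<in>?X. \<Sum>y\<in>?C. ?d' x y) = (\<Sum>x\<in>?X. \<Sum>y\<in>?C. ?d x y)"
    by (intro sum.cong refl) (subst comm(1), subst comm(2), rule keep, use BV in auto)
  also have "(\<Sum>x\<in>?X. \<Sum>y\<in>?X. ?d' x y) = (\<Sum>x\<in>?X. \<Sum>y\<in>?X. ?d x y)"
    by (intro sum.cong refl keep) (use v in auto)
  finally show "ordered_wiener (V - {v}) (del R v) = ordered_wiener V R + 2 * f"
    using 1 WB by simp
qed

text \<open>The new terminals lie at a common level e, so v is again equidistant from them, now at a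
  + e, and the hypotheses for the next attachment are restored.\<close>

lemma extends_excess:
  assumes B: "st_graph B RB s t" and V: "st_graph V R s' t'"
    and ext: "extends B RB s t V R lev"
    and exc: "excess B RB v s t a (f + (\<Sum>x\<in>V - B. a + lev x))"
    and new: "s' \<in> V - B" "t' \<in> V - B" "lev s' = e" "lev t' = e"
  shows "excess V R v s' t' (a + e) f"
proof -
  have "v \<in> B" "B \<subseteq> V" using ext exc unfolding extends_def excess_def by auto
  then show ?thesis unfolding excess_def
    using extends_gdist[OF assms(1-4)] extends_del_gdist[OF assms(1-4)]
      extends_wiener[OF assms(1-4)] new by auto
qed

section \<open>Translation to digraphs\<close>

definition to_graph :: "'a set \<Rightarrow> 'a rel \<Rightarrow> 'a pair_pre_digraph" where
  "to_graph V R = \<lparr>pverts = V, parcs = R\<rparr>"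

lemma to_graph_simps [simp]: "pverts (to_graph V R) = V" "parcs (to_graph V R) = R"
  by (simp_all add: to_graph_def)

lemma pair_graph_to_graph:
  assumes "simple_graph V R"
  shows "pair_graph (to_graph V R)"
proof -
  have "finite R" using assms finite_subset[of R "V \<times> V"] unfolding simple_graph_def by auto
  then show ?thesis using assms
    unfolding simple_graph_def
    by unfold_locales (auto simp: symmetric_def irrefl_def)
qed

lemma awalk_to_graph:
  assumes "simple_graph V R" "u \<in> V"
  shows "(\<exists>p. pre_digraph.awalk (with_proj (to_graph V R)) u p v \<and> length p = k) \<longleftrightarrow> (u, v) \<in> R ^^ k"
proof -
  interpret pair_graph "to_graph V R" using pair_graph_to_graph[OF assms(1)] .
  have RV: "R \<subseteq> V \<times> V" using assms(1) by (simp add: simple_graph_def)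
  have "(\<exists>p. awalk u p v \<and> length p = k) \<longleftrightarrow> (u, v) \<in> R ^^ k" if "u \<in> V" for u
    using that
  proof (induction k arbitrary: u)
    case 0
    then show ?case by (auto simp: awalk_Nil_iff)
  next
    case (Suc k)
    have "(\<exists>p. awalk u p v \<and> length p = Suc k)
        \<longleftrightarrow> (\<exists>w p. (u, w) \<in> R \<and> awalk w p v \<and> length p = k)"
    proof safe
      fix p assume "awalk u p v" "length p = Suc k"
      then show "\<exists>w p. (u, w) \<in> R \<and> awalk w p v \<and> length p = k"
        by (cases p) (force simp: awalk_Cons_iff)+
    next
      fix w p assume "(u, w) \<in> R" "awalk w p v" "k = length p"
      then show "\<exists>q. awalk u q v \<and> length q = Suc (length p)"
        by (intro exI[of _ "(u, w) # p"]) (auto simp: awalk_Cons_iff)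
    qed
    also have "\<dots> \<longleftrightarrow> (\<exists>w. (u, w) \<in> R \<and> (w, v) \<in> R ^^ k)"
      using Suc.IH RV by (metis (no_types, lifting) SigmaD2 subsetD)
    also have "\<dots> \<longleftrightarrow> (u, v) \<in> R ^^ Suc k"
      by (metis relpow_Suc_D2 relpow_Suc_I2)
    finally show ?case .
  qed
  then show ?thesis using assms(2) .
qed

lemma distance_to_graph:
  assumes "simple_graph V R" "u \<in> V" "(u, v) \<in> R\<^sup>*"
  shows "distance (with_proj (to_graph V R)) u v = ereal (real (gdist R u v))"
proof -
  interpret pair_graph "to_graph V R" using pair_graph_to_graph[OF assms(1)] .
  note walk = awalk_to_graph[OF assms(1,2), of v]
  show ?thesis unfolding distance_def \<mu>_def
  proof (rule antisym)
    obtain p where "awalk u p v" "length p = gdist R u v"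
      using walk gdist_path[OF assms(3)] by blast
    then show "(INF p\<in>{p. awalk u p v}. ereal (awalk_cost (\<lambda>_. 1) p)) \<le> ereal (real (gdist R u v))"
      by (intro INF_lower2[of p]) (auto simp: awalk_cost_unit)
    show "ereal (real (gdist R u v)) \<le> (INF p\<in>{p. awalk u p v}. ereal (awalk_cost (\<lambda>_. 1) p))"
      using walk by (intro INF_greatest) (auto simp: awalk_cost_unit intro!: gdist_le)
  qed
qed

lemma connected_to_graph:
  assumes "simple_graph V R" "V \<noteq> {}" "\<And>x y. x \<in> V \<Longrightarrow> y \<in> V \<Longrightarrow> (x, y) \<in> R\<^sup>*"
  shows "Digraph_Component.connected (with_proj (to_graph V R))"
proof -
  interpret pair_graph "to_graph V R" using pair_graph_to_graph[OF assms(1)] .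
  have "u \<rightarrow>\<^sup>*\<^bsub>with_proj (to_graph V R)\<^esub> v" if uv: "u \<in> V" "v \<in> V" for u v
  proof -
    obtain p where "awalk u p v"
      using awalk_to_graph[OF assms(1) uv(1), of v] gdist_path[OF assms(3)[OF uv]] by blast
    then show ?thesis by (rule reachable_awalkI)
  qed
  then show ?thesis
    using assms(2) reachable_mk_symmetricI unfolding connected_def
    by (intro strongly_connectedI) auto
qed

lemma wiener_to_graph:
  fixes V :: "nat set"
  assumes "simple_graph V R" "V \<noteq> {}" "\<And>x y. x \<in> V \<Longrightarrow> y \<in> V \<Longrightarrow> (x, y) \<in> R\<^sup>*"
  shows "wiener_index (with_proj (to_graph V R)) = ereal (real (ordered_wiener V R) / 2)"
proof -
  interpret pair_graph "to_graph V R" using pair_graph_to_graph[OF assms(1)] .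
  let ?P = "{(x, y) \<in> V \<times> V. x < y}"
  have V: "finite V" "sym R" using assms(1) by (auto simp: simple_graph_def)
  have "bij_betw (\<lambda>(x, y). {x, y}) ?P {e. e \<subseteq> V \<and> card e = 2}"
  proof (rule bij_betwI')
    fix e assume "e \<in> {e. e \<subseteq> V \<and> card e = 2}"
    then obtain x y where e: "e = {x, y}" "x \<noteq> y" "x \<in> V" "y \<in> V" by (auto simp: card_2_iff)
    show "\<exists>z\<in>?P. e = (case z of (x, y) \<Rightarrow> {x, y})"
    proof (cases "x < y")
      case True then show ?thesis using e by (intro bexI[of _ "(x, y)"]) auto
    next
      case False then show ?thesis using e by (intro bexI[of _ "(y, x)"]) auto
    qed
  qed (auto simp: doubleton_eq_iff card_2_iff)
  then have "(\<Sum>e\<in>{e. e \<subseteq> V \<and> card e = 2}. pair_distance (with_proj (to_graph V R)) e)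
    = (\<Sum>z\<in>?P. pair_distance (with_proj (to_graph V R)) (case z of (x, y) \<Rightarrow> {x, y}))"
    by (rule sum.reindex_bij_betw[symmetric])
  also have "\<dots> = (\<Sum>(x, y)\<in>?P. ereal (real (gdist R x y)))"
    by (intro sum.cong refl)
       (auto simp: pair_distance_eq distance_to_graph[OF assms(1)] assms(3))
  also have "\<dots> = ereal (real (\<Sum>(x, y)\<in>?P. gdist R x y))"
    by (simp only: case_prod_unfold sum_ereal of_nat_sum)
  also have "real (\<Sum>(x, y)\<in>?P. gdist R x y) = real (ordered_wiener V R) / 2"
    unfolding ordered_wiener_unordered[OF V] by simp
  finally show ?thesis
    using connected_to_graph[OF assms] by (simp add: wiener_index_def)
qed

lemma del_vert_to_graph:
  "pre_digraph.del_vert (with_proj (to_graph V R)) v = with_proj (to_graph (V - {v}) (del R v))"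
  by (auto simp: pre_digraph.del_vert_def with_proj_def del_def)

lemma induce_to_graph:
  assumes "R \<subseteq> V \<times> V"
  shows "with_proj (to_graph V R) \<restriction> (V - {v}) = with_proj (to_graph (V - {v}) (del R v))"
  using assms by (auto simp: induce_subgraph_def with_proj_def del_def)

lemma simple_graph_del: "simple_graph V R \<Longrightarrow> simple_graph (V - {v}) (del R v)"
  using sym_del[of R v] by (auto simp: simple_graph_def del_def irrefl_def)

lemma st_graph_vertex_connected:
  assumes "st_graph V R s t" "card V > 2"
  shows "vertex_connected 2 (with_proj (to_graph V R))"
  unfolding vertex_connected_def
proof (intro conjI allI impI)
  have sg: "simple_graph V R" and fin: "finite V" and RV: "R \<subseteq> V \<times> V"
    using assms(1) by (auto simp: st_graph_def simple_graph_def)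
  fix X assume "X \<subseteq> verts (with_proj (to_graph V R))" "card X < 2"
  then have X: "X \<subseteq> V" "card X = 0 \<or> card X = 1" by auto
  have finX: "finite X" using X(1) fin finite_subset by blast
  have del: "Digraph_Component.connected (with_proj (to_graph (V - {v}) (del R v)))" for v
  proof (rule connected_to_graph[OF simple_graph_del[OF sg]])
    show "V - {v} \<noteq> {}" using assms(2) card_mono[of "{v}" V] by auto
  qed (use st_graph_del_reaches[OF assms(1)] in auto)
  show "Digraph_Component.connected (with_proj (to_graph V R) \<restriction> (verts (with_proj (to_graph V R)) - X))"
  proof (cases "X = {}")
    case True
    have "with_proj (to_graph V R) \<restriction> V = with_proj (to_graph V R)"
      using RV by (auto simp: induce_subgraph_def with_proj_def)
    moreover have "V \<noteq> {}" using assms(2) by auto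
    ultimately show ?thesis
      using True connected_to_graph[OF sg] st_graph_reaches[OF assms(1)] by simp
  next
    case False
    then obtain v where "X = {v}" using X(2) finX by (auto simp: card_1_singleton_iff)
    then show ?thesis using del induce_to_graph[OF RV] by simp
  qed
qed (use assms in simp)

lemma soltes_to_graph:
  fixes V :: "nat set"
  assumes "st_graph V R s t" "card V > 2" "v \<in> V"
    and "ordered_wiener (V - {v}) (del R v) = ordered_wiener V R"
  shows "soltes_vertex (with_proj (to_graph V R)) v"
proof -
  have sg: "simple_graph V R" using assms(1) by (simp add: st_graph_def)
  have ne: "V - {v} \<noteq> {}" "V \<noteq> {}" using assms(2) card_mono[of "{v}" V] by auto
  have "wiener_index (with_proj (to_graph (V - {v}) (del R v))) = wiener_index (with_proj (to_graph V R))"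
    using wiener_to_graph[OF simple_graph_del[OF sg] ne(1) st_graph_del_reaches[OF assms(1)]]
      wiener_to_graph[OF sg ne(2) st_graph_reaches[OF assms(1)]] assms(4) by simp
  then show ?thesis using assms(3) by (simp add: soltes_vertex_def del_vert_to_graph)
qed

lemma cubic_to_graph:
  "cubic (with_proj (to_graph V R)) \<longleftrightarrow> (\<forall>x\<in>V. card (R `` {x}) = 3)"
proof -
  have "out_degree (with_proj (to_graph V R)) x = card (R `` {x})" for x
  proof -
    have "out_arcs (with_proj (to_graph V R)) x = Pair x ` (R `` {x})"
      by (auto simp: out_arcs_def)
    then show ?thesis by (simp add: out_degree_def card_image inj_on_def)
  qed
  then show ?thesis by (simp add: cubic_def)
qed

lemma digraph_iso_card:
  assumes "digraph_iso G H"
  shows "card (verts G) = card (verts H)"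
proof -
  obtain f where "pre_digraph.digraph_isomorphism G f" "H = app_iso f G"
    using assms by (auto simp: digraph_iso_def)
  then show ?thesis
    by (simp add: pre_digraph.digraph_isomorphism_def app_iso_def card_image)
qed

section \<open>Gadgets and gluing patterns\<close>

text \<open>Each terminal lacks one edge, so attaching one edge at each makes the old part cubic.
  All of \<open>S\<close> shares a and f, so that a single tail serves every vertex of
  \<open>S\<close>.\<close>

definition gadget :: "nat \<Rightarrow> nat rel \<Rightarrow> nat \<Rightarrow> nat \<Rightarrow> nat set \<Rightarrow> nat \<Rightarrow> nat \<Rightarrow> bool" where
  "gadget n R s t S a f \<longleftrightarrow> st_graph {..<n} R s t \<and>
     (\<forall>x<n. card (R `` {x}) = (if x = s \<or> x = t then 2 else 3)) \<and>
     S \<subseteq> {..<n} \<and> (\<forall>v\<in>S. excess {..<n} R v s t a f)"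

text \<open>A gadget with a fixed numbering and a bound \<open>M\<close> on its labels:
  \<open>M\<close> is the room to be made when the gadget is placed inside a larger
  numbering.\<close>

locale numbered =
  fixes n :: nat and R :: "nat rel" and s t :: nat and \<nu> :: "nat \<Rightarrow> nat" and M :: nat
  assumes Rn: "R \<subseteq> {..<n} \<times> {..<n}" and symR: "sym R" and irreflR: "irrefl R"
    and st: "s < n" "t < n" "(s, t) \<in> R"
    and lower: "\<And>x. x < n \<Longrightarrow> x \<noteq> s \<Longrightarrow> \<exists>y<n. (x, y) \<in> R \<and> \<nu> y < \<nu> x"
    and higher: "\<And>x. x < n \<Longrightarrow> x \<noteq> t \<Longrightarrow> \<exists>y<n. (x, y) \<in> R \<and> \<nu> x < \<nu> y"
    and bound: "\<And>x. x < n \<Longrightarrow> \<nu> x \<le> M"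
    and deg: "\<And>x. x < n \<Longrightarrow> card (R `` {x}) = (if x = s \<or> x = t then 2 else 3)"
begin

lemma basic: "s < n" "t < n" "s \<noteq> n + k" "t \<noteq> n + k" "n + k \<noteq> s" "n + k \<noteq> t"
    "s \<noteq> n" "t \<noteq> n" "n \<noteq> s" "n \<noteq> t" "(s, t) \<in> R" "(t, s) \<in> R" "s \<noteq> t" "t \<noteq> s"
  using st symR irreflR by (auto simp: irrefl_def dest: symD)

lemma out: "x \<ge> n \<Longrightarrow> R `` {x} = {}" "x \<ge> n \<or> y \<ge> n \<Longrightarrow> (x, y) \<notin> R" "x \<ge> n \<Longrightarrow> x \<notin> R `` A"
  using Rn by auto

lemma finite_nbrs: "finite (R `` {x})"
  using Rn by (auto intro!: finite_subset[of _ "{..<n}"])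

lemma simple: "simple_graph {..<n} R"
  using Rn symR irreflR by (simp add: simple_graph_def)

end

lemma gadget_numbering:
  assumes "gadget n R s t S a f"
  obtains \<nu> M where "numbered n R s t \<nu> M"
proof -
  have G: "st_graph {..<n} R s t"
    "\<And>x. x < n \<Longrightarrow> card (R `` {x}) = (if x = s \<or> x = t then 2 else 3)"
    using assms unfolding gadget_def by auto
  then have R: "R \<subseteq> {..<n} \<times> {..<n}" "sym R" "irrefl R" "s < n" "t < n" "(s, t) \<in> R"
    unfolding st_graph_def simple_graph_def by auto
  obtain \<nu> :: "nat \<Rightarrow> nat" where \<nu>: "\<And>x. x \<in> {..<n} \<Longrightarrow> x \<noteq> s \<Longrightarrow> \<exists>y. (x, y) \<in> R \<and> \<nu> y < \<nu> x"
      "\<And>x. x \<in> {..<n} \<Longrightarrow> x \<noteq> t \<Longrightarrow> \<exists>y. (x, y) \<in> R \<and> \<nu> x < \<nu> y"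
    using G(1) unfolding st_graph_def by (metis DiffI singletonD)
  have "numbered n R s t \<nu> (Max (\<nu> ` {..<n}))"
  proof
    show "\<exists>y<n. (x, y) \<in> R \<and> \<nu> y < \<nu> x" if "x < n" "x \<noteq> s" for x using \<nu>(1)[of x] that R(1) by auto
    show "\<exists>y<n. (x, y) \<in> R \<and> \<nu> x < \<nu> y" if "x < n" "x \<noteq> t" for x using \<nu>(2)[of x] that R(1) by auto
  qed (use R G(2) in auto)
  then show ?thesis by (rule that)
qed

section \<open>Enlarging and capping a gadget\<close>

lemma gadget_extend:
  assumes G: "gadget n R s t S a (f + (\<Sum>x=n..<n'. a + lev x))"
    and ext: "extends {..<n} R s t {..<n'} R' lev" and R': "st_graph {..<n'} R' s' t'"
    and deg: "\<And>x. x < n' \<Longrightarrow> card (R' `` {x}) = (if x = s' \<or> x = t' then 2 else 3)"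
    and new: "s' \<in> {n..<n'}" "t' \<in> {n..<n'}" "lev s' = e" "lev t' = e"
  shows "gadget n' R' s' t' S (a + e) f"
proof -
  have X: "{..<n'} - {..<n} = {n..<n'}" by auto
  have "st_graph {..<n} R s t" "S \<subseteq> {..<n}" and *: "\<And>v. v \<in> S \<Longrightarrow>
      excess {..<n} R v s t a (f + (\<Sum>x\<in>{..<n'} - {..<n}. a + lev x))"
    using G unfolding gadget_def X by auto
  then show ?thesis unfolding gadget_def
    using extends_excess[OF _ R' ext *] R' deg new X by (auto simp: subset_iff)
qed

text \<open>Here the attached vertices use up the whole surplus, so \<open>extends_wiener\<close>
  applies with f = 0.\<close>

lemma gadget_cap:
  assumes G: "gadget n R s t S a (\<Sum>x=n..<n'. a + lev x)"
    and ext: "extends {..<n} R s t {..<n'} R' lev" and R': "st_graph {..<n'} R' s' t'" and v: "v \<in> S"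
  shows "ordered_wiener ({..<n'} - {v}) (del R' v) = ordered_wiener {..<n'} R'"
proof -
  have X: "{..<n'} - {..<n} = {n..<n'}" by auto
  have "st_graph {..<n} R s t" "excess {..<n} R v s t a (0 + (\<Sum>x\<in>{..<n'} - {..<n}. a + lev x))"
    using G v unfolding gadget_def X by auto
  from extends_wiener[OF this(1) R' ext this(2)] show ?thesis by simp
qed

lemma extendsI:
  assumes "V \<subseteq> V'" "R = R' \<inter> V \<times> V" "\<And>x y. x \<in> V \<Longrightarrow> (x, y) \<in> R' \<Longrightarrow> y \<notin> V \<Longrightarrow> x = s \<or> x = t"
    "\<And>x. x \<in> V \<Longrightarrow> lev x = 0" "\<And>x y. (x, y) \<in> R' \<Longrightarrow> lev x \<le> lev y + 1"
    "\<And>x. x \<in> V' \<Longrightarrow> x \<notin> V \<Longrightarrow> \<exists>y. (x, y) \<in> R' \<and> lev y < lev x"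
  shows "extends V R s t V' R' lev"
  using assms unfolding extends_def by auto

context numbered
begin

text \<open>Shifting by c keeps the order of the old labels, so only \<open>s\<close> and
  \<open>t\<close>, which are no longer extremal, need a new neighbour below and above
  respectively.\<close>

lemma st_graph_Un:
  assumes E: "sym E" "irrefl E" "E \<subseteq> {..<n'} \<times> {..<n'}" and n': "n \<le> n'"
    and st': "(s', t') \<in> E" "n \<le> s'" "n \<le> t'"
    and \<nu>': "\<And>x. x < n \<Longrightarrow> \<nu>' x = \<nu> x + c"
    and lo: "\<And>x. n \<le> x \<Longrightarrow> x < n' \<Longrightarrow> x \<noteq> s' \<Longrightarrow> \<exists>y. (x, y) \<in> E \<and> \<nu>' y < \<nu>' x"
      "\<exists>y. (s, y) \<in> E \<and> \<nu>' y < \<nu>' s"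
    and hi: "\<And>x. n \<le> x \<Longrightarrow> x < n' \<Longrightarrow> x \<noteq> t' \<Longrightarrow> \<exists>y. (x, y) \<in> E \<and> \<nu>' x < \<nu>' y"
      "\<exists>y. (t, y) \<in> E \<and> \<nu>' t < \<nu>' y"
  shows "st_graph {..<n'} (R \<union> E) s' t'"
  unfolding st_graph_def
proof (intro conjI exI[of _ \<nu>'] ballI)
  show "simple_graph {..<n'} (R \<union> E)"
    using simple E n' unfolding simple_graph_def irrefl_def by (auto intro: sym_Un)
  fix x assume x: "x \<in> {..<n'} - {s'}"
  show "\<exists>y. (x, y) \<in> R \<union> E \<and> \<nu>' y < \<nu>' x"
  proof (cases "x < n \<and> x \<noteq> s")
    case True
    then show ?thesis using lower[of x] by (auto simp: \<nu>')
  next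
    case False then show ?thesis using lo(1)[of x] lo(2) x by auto
  qed
next
  fix x assume x: "x \<in> {..<n'} - {t'}"
  show "\<exists>y. (x, y) \<in> R \<union> E \<and> \<nu>' x < \<nu>' y"
  proof (cases "x < n \<and> x \<noteq> t")
    case True
    then show ?thesis using higher[of x] by (auto simp: \<nu>')
  next
    case False then show ?thesis using hi(1)[of x] hi(2) x by auto
  qed
qed (use E(3) st' in auto)

lemma extends_Un:
  assumes "n \<le> n'" "E \<inter> {..<n} \<times> {..<n} = {}"
    and "\<And>x y. (x, y) \<in> E \<Longrightarrow> x < n \<Longrightarrow> x = s \<or> x = t"
    and "\<And>x. x < n \<Longrightarrow> lev x = 0" "\<And>x y. (x, y) \<in> E \<Longrightarrow> lev x \<le> lev y + 1"
    and "\<And>x. n \<le> x \<Longrightarrow> x < n' \<Longrightarrow> \<exists>y. (x, y) \<in> E \<and> lev y < lev x"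
  shows "extends {..<n} R s t {..<n'} (R \<union> E) lev"
proof (rule extendsI)
  show "R = (R \<union> E) \<inter> {..<n} \<times> {..<n}" using assms(2) Rn by auto
  show "x = s \<or> x = t" if "x \<in> {..<n}" "(x, y) \<in> R \<union> E" "y \<notin> {..<n}" for x y
    using that assms(3)[of x y] Rn by auto
  show "lev x \<le> lev y + 1" if "(x, y) \<in> R \<union> E" for x y
    using that assms(4)[of x] assms(5)[of x y] Rn by auto
  show "\<exists>y. (x, y) \<in> R \<union> E \<and> lev y < lev x" if "x \<in> {..<n'}" "x \<notin> {..<n}" for x
    using that assms(6)[of x] by auto
qed (use assms(1,4) in auto)

end

text \<open>
  A pattern describes what is glued to a gadget, with label \<open>0\<close> for \<open>s\<close>, label
  \<open>1\<close> for \<open>t\<close> and label \<open>i + 2\<close> for the new vertex \<open>n + i\<close>. The whole old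
  gadget sits at position \<open>c\<close> of the new numbering \<open>\<mu>\<close>.
\<close>

locale pattern =
  fixes k :: nat and P :: "nat rel" and \<mu> lev :: "nat \<Rightarrow> nat" and c p q :: nat
  assumes symP: "sym P" and irreflP: "irrefl P" and Pk: "P \<subseteq> {..<k + 2} \<times> {..<k + 2}"
    and new: "\<And>i j. (i, j) \<in> P \<Longrightarrow> 2 \<le> i \<or> 2 \<le> j"
    and pq: "(p, q) \<in> P" "2 \<le> p" "2 \<le> q"
    and low: "\<And>i. i < k + 2 \<Longrightarrow> i \<noteq> 1 \<Longrightarrow> i \<noteq> p \<Longrightarrow> \<exists>j. (i, j) \<in> P \<and> \<mu> j < \<mu> i"
    and high: "\<And>i. i < k + 2 \<Longrightarrow> i \<noteq> 0 \<Longrightarrow> i \<noteq> q \<Longrightarrow> \<exists>j. (i, j) \<in> P \<and> \<mu> i < \<mu> j"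
    and \<mu>c: "\<mu> 0 = c" "\<mu> 1 = c" "\<And>i. 2 \<le> i \<Longrightarrow> i < k + 2 \<Longrightarrow> \<mu> i \<noteq> c"
    and lev0: "lev 0 = 0" "lev 1 = 0" and lev: "\<And>i j. (i, j) \<in> P \<Longrightarrow> lev i \<le> lev j + 1"
    and down: "\<And>i. 2 \<le> i \<Longrightarrow> i < k + 2 \<Longrightarrow> \<exists>j. (i, j) \<in> P \<and> lev j < lev i"
    and deg01: "card (P `` {0}) = 1" "card (P `` {1}) = 1"

definition place :: "nat \<Rightarrow> nat \<Rightarrow> nat \<Rightarrow> nat \<Rightarrow> nat" where
  "place n s t i = (if i = 0 then s else if i = 1 then t else n + (i - 2))"

definition glue :: "nat \<Rightarrow> nat rel \<Rightarrow> nat \<Rightarrow> nat \<Rightarrow> nat rel \<Rightarrow> nat rel" where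
  "glue n R s t P = R \<union> map_prod (place n s t) (place n s t) ` P"

locale glueing = numbered + pattern
begin

abbreviation \<iota> where "\<iota> \<equiv> place n s t"
abbreviation E where "E \<equiv> map_prod \<iota> \<iota> ` P"

lemma place_simps: "\<iota> 0 = s" "\<iota> 1 = t" "\<iota> (Suc 0) = t" "2 \<le> i \<Longrightarrow> \<iota> i = n + (i - 2)"
  by (auto simp: place_def)

lemma place_less: "i < k + 2 \<Longrightarrow> \<iota> i < n + k"
  using st by (auto simp: place_def)

lemma place_old: "\<iota> i < n \<longleftrightarrow> i < 2"
  using st by (auto simp: place_def)

lemma inj_place: "inj \<iota>"
  using basic by (auto simp: inj_def place_def split: if_splits)

lemma edge_iff: "(\<iota> i, \<iota> j) \<in> E \<longleftrightarrow> (i, j) \<in> P"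
  by (auto dest: injD[OF inj_place])

lemma new_vertex:
  assumes "n \<le> x" "x < n + k"
  obtains i where "2 \<le> i" "i < k + 2" "x = \<iota> i"
  using that[of "x - n + 2"] assms by (simp add: place_def)

definition lev' where "lev' x = (if x < n then 0 else lev (x - n + 2))"
text \<open>The old gadget fills the interval from c to c + \<open>M\<close>, so pattern labels
  above c are pushed up by \<open>M\<close> and strict inequalities between pattern labels
  persist.\<close>

definition \<nu>' where "\<nu>' x = (if x < n then \<nu> x + c
  else if \<mu> (x - n + 2) < c then \<mu> (x - n + 2) else \<mu> (x - n + 2) + M)"

lemma lev'_place: "i < k + 2 \<Longrightarrow> lev' (\<iota> i) = lev i"
  using st lev0 le_add_diff_inverse2[of 2 i] by (auto simp: lev'_def place_def)

lemma \<nu>'_place: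
  assumes "i < k + 2"
  shows "\<mu> i < c \<Longrightarrow> \<nu>' (\<iota> i) = \<mu> i" "c < \<mu> i \<Longrightarrow> \<nu>' (\<iota> i) = \<mu> i + M"
    "\<mu> i = c \<Longrightarrow> c \<le> \<nu>' (\<iota> i) \<and> \<nu>' (\<iota> i) \<le> c + M"
proof -
  consider "i = 0" | "i = 1" | "2 \<le> i" by arith
  then have "(\<mu> i < c \<longrightarrow> \<nu>' (\<iota> i) = \<mu> i) \<and> (c < \<mu> i \<longrightarrow> \<nu>' (\<iota> i) = \<mu> i + M) \<and>
      (\<mu> i = c \<longrightarrow> c \<le> \<nu>' (\<iota> i) \<and> \<nu>' (\<iota> i) \<le> c + M)"
  proof cases
    case 3
    then obtain m where m: "i = m + 2" by (metis add.commute le_Suc_ex)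
    then have "\<iota> i = n + m" by (simp add: place_def)
    then show ?thesis using \<mu>c(3)[of i] assms 3 m by (simp add: \<nu>'_def)
  qed (use st bound[of s] bound[of t] \<mu>c(1,2) in \<open>simp_all add: \<nu>'_def place_def\<close>)
  then show "\<mu> i < c \<Longrightarrow> \<nu>' (\<iota> i) = \<mu> i" "c < \<mu> i \<Longrightarrow> \<nu>' (\<iota> i) = \<mu> i + M"
    "\<mu> i = c \<Longrightarrow> c \<le> \<nu>' (\<iota> i) \<and> \<nu>' (\<iota> i) \<le> c + M" by auto
qed

lemma \<nu>'_mono:
  assumes "i < k + 2" "j < k + 2" "\<mu> i < \<mu> j"
  shows "\<nu>' (\<iota> i) < \<nu>' (\<iota> j)"
  using \<nu>'_place[OF assms(1)] \<nu>'_place[OF assms(2)] assms(3) by linarith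

lemma P_less: "(i, j) \<in> P \<Longrightarrow> i < k + 2" "(i, j) \<in> P \<Longrightarrow> j < k + 2"
  using Pk by auto

lemma st_graph_glue: "st_graph {..<n + k} (glue n R s t P) (\<iota> p) (\<iota> q)"
  unfolding glue_def
proof (rule st_graph_Un[where \<nu>' = \<nu>' and c = c])
  show "sym E" using symP by (auto simp: sym_def)
  show "irrefl E" using irreflP inj_place by (auto simp: irrefl_def inj_def)
  show "E \<subseteq> {..<n + k} \<times> {..<n + k}" using P_less place_less by auto
  show "(\<iota> p, \<iota> q) \<in> E" using pq edge_iff by simp
  show "\<exists>y. (x, y) \<in> E \<and> \<nu>' y < \<nu>' x" if x: "n \<le> x" "x < n + k" "x \<noteq> \<iota> p" for x
  proof -
    obtain i where "2 \<le> i" "i < k + 2" "x = \<iota> i" using new_vertex x(1,2) .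
    moreover obtain j where "(i, j) \<in> P" "\<mu> j < \<mu> i" using low[of i] calculation x by auto
    ultimately show ?thesis using \<nu>'_mono P_less edge_iff by blast
  qed
  show "\<exists>y. (x, y) \<in> E \<and> \<nu>' x < \<nu>' y" if x: "n \<le> x" "x < n + k" "x \<noteq> \<iota> q" for x
  proof -
    obtain i where "2 \<le> i" "i < k + 2" "x = \<iota> i" using new_vertex x(1,2) .
    moreover obtain j where "(i, j) \<in> P" "\<mu> i < \<mu> j" using high[of i] calculation x by auto
    ultimately show ?thesis using \<nu>'_mono P_less edge_iff by blast
  qed
  obtain j where "(0, j) \<in> P" "\<mu> j < \<mu> 0" using low[of 0] pq by auto
  then show "\<exists>y. (s, y) \<in> E \<and> \<nu>' y < \<nu>' s"
    using \<nu>'_mono[of j 0] edge_iff[of 0 j] P_less[of 0 j] place_simps(1) by (metis add_2_eq_Suc' zero_less_Suc)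
  obtain j where "(1, j) \<in> P" "\<mu> 1 < \<mu> j" using high[of 1] pq by auto
  then show "\<exists>y. (t, y) \<in> E \<and> \<nu>' t < \<nu>' y"
    using \<nu>'_mono[of 1 j] edge_iff[of 1 j] P_less[of 1 j] place_simps(2) by metis
qed (use pq place_old[of p] place_old[of q] in \<open>auto simp: \<nu>'_def\<close>)

lemma edge_old:
  assumes "(x, y) \<in> E" "x < n"
  shows "x = s \<or> x = t"
proof -
  obtain i where i: "x = \<iota> i" using assms(1) by auto
  then have "i = 0 \<or> i = 1" using place_old[of i] assms(2) by auto
  then show ?thesis unfolding i place_def by auto
qed

lemma extends_glue: "extends {..<n} R s t {..<n + k} (glue n R s t P) lev'"
  unfolding glue_def
proof (rule extends_Un)
  show "E \<inter> {..<n} \<times> {..<n} = {}" using new place_old by fastforce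
  show "x = s \<or> x = t" if "(x, y) \<in> E" "x < n" for x y
    using that edge_old by blast
  show "lev' x \<le> lev' y + 1" if xy: "(x, y) \<in> E" for x y
  proof -
    obtain i j where "(i, j) \<in> P" "x = \<iota> i" "y = \<iota> j" using xy by auto
    then show ?thesis using lev lev'_place P_less by simp
  qed
  show "\<exists>y. (x, y) \<in> E \<and> lev' y < lev' x" if x: "n \<le> x" "x < n + k" for x
  proof -
    obtain i where "2 \<le> i" "i < k + 2" "x = \<iota> i" using new_vertex x .
    moreover obtain j where "(i, j) \<in> P" "lev j < lev i" using down[of i] calculation by auto
    ultimately show ?thesis using lev'_place P_less edge_iff by metis
  qed
qed (auto simp: lev'_def)

lemma glue_nbrs: "E `` {\<iota> i} = \<iota> ` (P `` {i})"
  by (auto dest: injD[OF inj_place])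

lemma deg_new:
  assumes "2 \<le> i" "i < k + 2"
  shows "card (glue n R s t P `` {\<iota> i}) = card (P `` {i})"
proof -
  have "R `` {\<iota> i} = {}" using out(1) place_old[of i] assms by simp
  then show ?thesis unfolding glue_def Un_Image glue_nbrs
    using inj_place by (simp add: card_image inj_on_subset)
qed

text \<open>At each of the two terminals exactly one edge is added; it leads to a new vertex and is
  therefore not present already. No other old vertex gains an edge.\<close>

lemma deg_old:
  assumes "x < n"
  shows "card (glue n R s t P `` {x}) = 3"
proof (cases "x = s \<or> x = t")
  case True
  then obtain i where i: "i < 2" "x = \<iota> i" "card (P `` {i}) = 1"
    using place_simps deg01 by (metis one_less_numeral_iff pos2 semiring_norm(76))
  then obtain j where j: "P `` {i} = {j}" by (auto simp: card_1_singleton_iff)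
  then have "2 \<le> j" using new[of i j] i by auto
  then have "\<iota> j \<notin> R `` {x}" using out(2)[of "\<iota> j"] out(2)[of x "\<iota> j"] place_old[of j] by auto
  moreover have "glue n R s t P `` {x} = insert (\<iota> j) (R `` {x})"
    unfolding glue_def Un_Image i(2) glue_nbrs j by auto
  ultimately show ?thesis using deg[of x] assms True finite_nbrs by simp
next
  case False
  then have "E `` {x} = {}" using assms edge_old by blast
  then show ?thesis unfolding glue_def Un_Image using deg[OF assms] False by simp
qed

lemma sum_lev': "(\<Sum>x=n..<n + k. a + lev' x) = (\<Sum>i=2..<k + 2. a + lev i)"
  by (rule sum.reindex_bij_witness[of _ "\<lambda>i. n + (i - 2)" "\<lambda>x. x - n + 2"])
     (auto simp: lev'_def)

end

context pattern
begin

lemma gadget_glue: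
  assumes G: "gadget n R s t S a (f + (\<Sum>i=2..<k + 2. a + lev i))"
    and deg': "\<And>i. 2 \<le> i \<Longrightarrow> i < k + 2 \<Longrightarrow> card (P `` {i}) = (if i = p \<or> i = q then 2 else 3)"
    and e: "lev p = e" "lev q = e"
  shows "gadget (n + k) (glue n R s t P) (n + (p - 2)) (n + (q - 2)) S (a + e) f"
proof -
  obtain \<nu> M where "numbered n R s t \<nu> M" using gadget_numbering[OF G] .
  then interpret numbered n R s t \<nu> M .
  interpret glueing n R s t \<nu> M k P \<mu> lev c p q ..
  have pq': "\<iota> p = n + (p - 2)" "\<iota> q = n + (q - 2)" using pq by (auto simp: place_def)
  show ?thesis
  proof (rule gadget_extend[OF G[folded sum_lev'] extends_glue st_graph_glue[unfolded pq']])
    fix x assume x: "x < n + k"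
    show "card (glue n R s t P `` {x}) = (if x = n + (p - 2) \<or> x = n + (q - 2) then 2 else 3)"
    proof (cases "x < n")
      case False
      then obtain i where i: "2 \<le> i" "i < k + 2" "x = \<iota> i" using new_vertex[of x] x by auto
      have "x = \<iota> p \<longleftrightarrow> i = p" "x = \<iota> q \<longleftrightarrow> i = q" using inj_place i(3) by (auto simp: inj_def)
      then show ?thesis using deg_new[OF i(1,2)] deg'[OF i(1,2)] i(3) pq' by simp
    qed (use deg_old in auto)
  qed (use pq P_less[OF pq(1)] lev'_place[of p] lev'_place[of q] e pq' in auto)
qed

text \<open>A cap leaves no vertex of degree 2; p and q remain only as the ends of the edge on which
  the st-numbering rests.\<close>

lemma cap_glue:
  assumes G: "gadget n R s t S a (\<Sum>i=2..<k + 2. a + lev i)"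
    and deg': "\<And>i. 2 \<le> i \<Longrightarrow> i < k + 2 \<Longrightarrow> card (P `` {i}) = 3"
  shows "st_graph {..<n + k} (glue n R s t P) (n + (p - 2)) (n + (q - 2))"
    and "x < n + k \<Longrightarrow> card (glue n R s t P `` {x}) = 3"
    and "v \<in> S \<Longrightarrow> ordered_wiener ({..<n + k} - {v}) (del (glue n R s t P) v)
           = ordered_wiener {..<n + k} (glue n R s t P)"
proof -
  obtain \<nu> M where "numbered n R s t \<nu> M" using gadget_numbering[OF G] .
  then interpret numbered n R s t \<nu> M .
  interpret glueing n R s t \<nu> M k P \<mu> lev c p q ..
  show "st_graph {..<n + k} (glue n R s t P) (n + (p - 2)) (n + (q - 2))"
    using st_graph_glue pq by (simp add: place_def)
  show "card (glue n R s t P `` {x}) = 3" if x: "x < n + k"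
  proof (cases "x < n")
    case False
    then obtain i where i: "2 \<le> i" "i < k + 2" "x = \<iota> i" using new_vertex[of x] x by auto
    then show ?thesis using deg_new deg' by simp
  qed (use deg_old in auto)
  show "ordered_wiener ({..<n + k} - {v}) (del (glue n R s t P) v)
      = ordered_wiener {..<n + k} (glue n R s t P)" if "v \<in> S"
    using gadget_cap[OF G[folded sum_lev'] extends_glue st_graph_glue that] .
qed

end


section \<open>Verifying concrete patterns by evaluation\<close>

definition nbrs :: "(nat \<times> nat) list \<Rightarrow> nat \<Rightarrow> nat list" where
  "nbrs es i = map snd (filter (\<lambda>e. fst e = i) es)"

text \<open>The conditions of \<open>pattern\<close> with edges, labels and levels given as lists,
  and witnesses sought among listed neighbours, so that \<open>code_simp\<close> decides
  them.\<close>

definition pattern_check ::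
    "nat \<Rightarrow> (nat \<times> nat) list \<Rightarrow> nat list \<Rightarrow> nat list \<Rightarrow> nat \<Rightarrow> nat \<Rightarrow> nat \<Rightarrow> bool" where
  "pattern_check k es \<mu> lev c p q \<longleftrightarrow>
     list_all (\<lambda>(i, j). (j, i) \<in> set es \<and> i \<noteq> j \<and> i < k + 2 \<and> j < k + 2 \<and> (2 \<le> i \<or> 2 \<le> j)
       \<and> lev ! i \<le> lev ! j + 1) es \<and>
     (p, q) \<in> set es \<and> 2 \<le> p \<and> 2 \<le> q \<and>
     list_all (\<lambda>i. i = 1 \<or> i = p \<or> list_ex (\<lambda>j. \<mu> ! j < \<mu> ! i) (nbrs es i)) [0..<k + 2] \<and>
     list_all (\<lambda>i. i = 0 \<or> i = q \<or> list_ex (\<lambda>j. \<mu> ! i < \<mu> ! j) (nbrs es i)) [0..<k + 2] \<and>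
     \<mu> ! 0 = c \<and> \<mu> ! 1 = c \<and> list_all (\<lambda>i. \<mu> ! i \<noteq> c) [2..<k + 2] \<and>
     lev ! 0 = 0 \<and> lev ! 1 = 0 \<and>
     list_all (\<lambda>i. list_ex (\<lambda>j. lev ! j < lev ! i) (nbrs es i)) [2..<k + 2] \<and>
     length (remdups (nbrs es 0)) = 1 \<and> length (remdups (nbrs es 1)) = 1"

lemma Image_nbrs: "set es `` {i} = set (nbrs es i)"
  by (force simp: nbrs_def)

lemma pattern_checkD:
  assumes "pattern_check k es \<mu> lev c p q"
  shows "pattern k (set es) ((!) \<mu>) ((!) lev) c p q"
proof -
  have nb: "j \<in> set (nbrs es i) \<longleftrightarrow> (i, j) \<in> set es" for i j
    by (force simp: nbrs_def)
  have edge: "(j, i) \<in> set es \<and> i \<noteq> j \<and> i < k + 2 \<and> j < k + 2 \<and> (2 \<le> i \<or> 2 \<le> j) \<and> lev ! i \<le> lev ! j + 1"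
    if "(i, j) \<in> set es" for i j
    using assms that by (auto simp: pattern_check_def list_all_iff)
  note * = assms[unfolded pattern_check_def list_all_iff list_ex_iff Bex_def nb]
  show ?thesis
  proof
    show "sym (set es)" "irrefl (set es)" using edge by (auto simp: sym_def irrefl_def)
    show "set es \<subseteq> {..<k + 2} \<times> {..<k + 2}" using edge by auto
    show "\<And>i j. (i, j) \<in> set es \<Longrightarrow> 2 \<le> i \<or> 2 \<le> j" "\<And>i j. (i, j) \<in> set es \<Longrightarrow> lev ! i \<le> lev ! j + 1"
      using edge by blast+
    show "card (set es `` {0}) = 1" "card (set es `` {1}) = 1"
      using * by (simp_all add: Image_nbrs card_set)
    show "\<exists>j. (i, j) \<in> set es \<and> \<mu> ! j < \<mu> ! i" if "i < k + 2" "i \<noteq> 1" "i \<noteq> p" for i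
      using * that by (metis atLeastLessThan_iff le0 set_upt)
    show "\<exists>j. (i, j) \<in> set es \<and> \<mu> ! i < \<mu> ! j" if "i < k + 2" "i \<noteq> 0" "i \<noteq> q" for i
      using * that by (metis atLeastLessThan_iff le0 set_upt)
    show "\<exists>j. (i, j) \<in> set es \<and> lev ! j < lev ! i" if "2 \<le> i" "i < k + 2" for i
      using * that by (metis atLeastLessThan_iff set_upt)
    show "\<mu> ! i \<noteq> c" if "2 \<le> i" "i < k + 2" for i
      using * that by (metis atLeastLessThan_iff set_upt)
  qed (use * in simp_all)
qed

lemma pattern_deg:
  assumes "list_all (\<lambda>i. length (remdups (nbrs es i)) = d i) [2..<k + 2]"
  shows "2 \<le> i \<Longrightarrow> i < k + 2 \<Longrightarrow> card (set es `` {i}) = d i"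
  using assms by (auto simp: list_all_iff Image_nbrs card_set simp del: upt_Suc)

definition solution :: "nat \<Rightarrow> nat rel \<Rightarrow> nat set \<Rightarrow> bool" where
  "solution n R S \<longleftrightarrow> (\<exists>s t. st_graph {..<n} R s t) \<and> (\<forall>x<n. card (R `` {x}) = 3) \<and> S \<subseteq> {..<n} \<and>
     (\<forall>v\<in>S. ordered_wiener ({..<n} - {v}) (del R v) = ordered_wiener {..<n} R)"

lemma (in pattern) solution_glue:
  assumes G: "gadget n R s t S a (\<Sum>i=2..<k + 2. a + lev i)"
    and deg': "\<And>i. 2 \<le> i \<Longrightarrow> i < k + 2 \<Longrightarrow> card (P `` {i}) = 3"
  shows "solution (n + k) (glue n R s t P) S"
proof -
  have "S \<subseteq> {..<n + k}" using G unfolding gadget_def by auto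
  then show ?thesis unfolding solution_def using cap_glue[OF assms] by blast
qed

section \<open>Tails\<close>

text \<open>One ladder rung: two adjacent vertices at level 1, numbered one below and one above the
  old gadget, at a cost of 2 * (a + 1).\<close>

lemma gadget_rung:
  assumes G: "gadget n R s t S a (f + (2 * a + 2))"
  shows "\<exists>R' s' t'. gadget (n + 2) R' s' t' S (a + 1) f"
proof -
  let ?es = "[(0, 2), (1, 3), (2, 3), (2, 0), (3, 1), (3, 2)]" and ?lev = "[0, 0, 1, 1]"
  have "pattern_check 2 ?es [1, 1, 0, 2] ?lev 1 2 3" by code_simp
  then interpret pattern 2 "set ?es" "(!) [1, 1, 0, 2]" "(!) ?lev" 1 2 3 by (rule pattern_checkD)
  have "list_all (\<lambda>i. length (remdups (nbrs ?es i)) = (if i = 2 \<or> i = 3 then 2 else 3)) [2..<2 + 2]"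
    by code_simp
  note deg = pattern_deg[OF this]
  have "{2..<2 + 2} = {2, 3 :: nat}" by auto
  then have "(\<Sum>i=2..<2 + 2. a + ?lev ! i) = 2 * a + 2" by simp
  from gadget_glue[OF G[folded this] deg, of 1] show ?thesis by auto
qed

text \<open>Layers of sizes 2, 4, 2. Compared with three rungs there are two more vertices at level
  2, an extra cost of 2 * (a + 2); inserting the bulge one layer further out therefore costs 2
  more.\<close>

lemma gadget_bulge:
  assumes G: "gadget n R s t S a (f + (8 * a + 16))"
  shows "\<exists>R' s' t'. gadget (n + 8) R' s' t' S (a + 3) f"
proof -
  let ?e = "[(0, 2), (1, 3), (2, 4), (2, 5), (3, 6), (3, 7), (4, 5), (5, 6), (6, 7), (4, 8), (7, 9), (8, 9)]"
  let ?es = "?e @ map prod.swap ?e" and ?lev = "[0, 0, 1, 1, 2, 2, 2, 2, 3, 3]"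
  let ?\<mu> = "[4, 4, 2, 5, 1, 3, 6, 7, 0, 8]"
  have "pattern_check 8 ?es ?\<mu> ?lev 4 8 9" by code_simp
  then interpret pattern 8 "set ?es" "(!) ?\<mu>" "(!) ?lev" 4 8 9 by (rule pattern_checkD)
  have "list_all (\<lambda>i. length (remdups (nbrs ?es i)) = (if i = 8 \<or> i = 9 then 2 else 3)) [2..<8 + 2]"
    by code_simp
  note deg = pattern_deg[OF this]
  have "{2..<8 + 2} = {2, 3, 4, 5, 6, 7, 8, 9 :: nat}" by auto
  then have "(\<Sum>i=2..<8 + 2. a + ?lev ! i) = 8 * a + 16" by simp
  from gadget_glue[OF G[folded this] deg, of 3] show ?thesis by auto
qed

text \<open>Layers of sizes 2 and 4, the last one closed to a 4-cycle; the levels sum to 10.\<close>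

lemma cap_even:
  assumes G: "gadget n R s t S a (6 * a + 10)"
  shows "\<exists>R'. solution (n + 6) R' S"
proof -
  let ?e = "[(0, 2), (1, 3), (2, 4), (2, 5), (3, 6), (3, 7), (4, 5), (5, 6), (6, 7), (4, 7)]"
  let ?es = "?e @ map prod.swap ?e" and ?lev = "[0, 0, 1, 1, 2, 2, 2, 2]"
  let ?\<mu> = "[3, 3, 1, 4, 0, 2, 5, 6]"
  have "pattern_check 6 ?es ?\<mu> ?lev 3 4 7" by code_simp
  then interpret pattern 6 "set ?es" "(!) ?\<mu>" "(!) ?lev" 3 4 7 by (rule pattern_checkD)
  have "list_all (\<lambda>i. length (remdups (nbrs ?es i)) = 3) [2..<6 + 2]" by code_simp
  note deg = pattern_deg[OF this]
  have "{2..<6 + 2} = {2, 3, 4, 5, 6, 7 :: nat}" by auto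
  then have "(\<Sum>i=2..<6 + 2. a + ?lev ! i) = 6 * a + 10" by simp
  from solution_glue[OF G[folded this] deg] show ?thesis by blast
qed

text \<open>Again six vertices, but in layers of sizes 2, 3, 1, so the levels sum to 11: this is the
  parity correction. Labels 4 and 7 have the same value of \<open>?\<mu>\<close>, which is harmless
  since each has a strictly lower and a strictly higher neighbour elsewhere.\<close>

lemma cap_odd:
  assumes G: "gadget n R s t S a (6 * a + 11)"
  shows "\<exists>R'. solution (n + 6) R' S"
proof -
  let ?e = "[(0, 2), (1, 3), (2, 4), (2, 5), (3, 4), (3, 6), (5, 6), (4, 7), (5, 7), (6, 7)]"
  let ?es = "?e @ map prod.swap ?e" and ?lev = "[0, 0, 1, 1, 2, 2, 2, 3]"
  let ?\<mu> = "[3, 3, 1, 4, 2, 0, 5, 2]"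
  have "pattern_check 6 ?es ?\<mu> ?lev 3 5 6" by code_simp
  then interpret pattern 6 "set ?es" "(!) ?\<mu>" "(!) ?lev" 3 5 6 by (rule pattern_checkD)
  have "list_all (\<lambda>i. length (remdups (nbrs ?es i)) = 3) [2..<6 + 2]" by code_simp
  note deg = pattern_deg[OF this]
  have "{2..<6 + 2} = {2, 3, 4, 5, 6, 7 :: nat}" by auto
  then have "(\<Sum>i=2..<6 + 2. a + ?lev ! i) = 6 * a + 11" by simp
  from solution_glue[OF G[folded this] deg] show ?thesis by blast
qed

text \<open>Rungs at levels j = 1, ..., i cost 2 * (a + j) each, which sums to i * (2 * a + 1 +
  i).\<close>

lemma gadget_rungs:
  assumes "gadget n R s t S a (f + i * (2 * a + 1 + i))"
  shows "\<exists>R' s' t'. gadget (n + 2 * i) R' s' t' S (a + i) f"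
  using assms
proof (induction i arbitrary: n R s t a)
  case 0
  then show ?case by auto
next
  case (Suc i)
  have "f + Suc i * (2 * a + 1 + Suc i) = f + i * (2 * (a + 1) + 1 + i) + (2 * a + 2)"
    by (simp add: algebra_simps)
  with Suc.prems obtain R' s' t' where "gadget (n + 2) R' s' t' S (a + 1) (f + i * (2 * (a + 1) + 1 + i))"
    using gadget_rung by metis
  from Suc.IH[OF this] show ?case by (auto simp: add.commute add.left_commute)
qed

text \<open>
  A tail of \<open>L\<close> layers of two vertices, except that the layers at depths \<open>c1\<close> and
  \<open>c2\<close> have four, followed by a cap. Varying \<open>c1 + c2\<close> and the cap covers the gap between
  consecutive values of \<open>L\<close> as soon as \<open>L\<close> exceeds \<open>a\<close>.
\<close>

lemma solution_tail:
  assumes G: "gadget n R s t S a f"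
    and f: "f = L * (2 * a) + L * (L + 1) + 10 * a + 6 * L + 10 + 2 * (c1 + c2) + d"
    and c: "2 \<le> c1" "c1 + 3 \<le> c2" "c2 + 1 \<le> L" and d: "d = 0 \<or> d = 1"
  shows "\<exists>n' R'. n \<le> n' \<and> solution n' R' S"
proof -
  \<comment> \<open>The tail is i rungs, a bulge, j rungs, a bulge, l rungs. The large layer of a
    bulge is its second, hence c1 = i + 2 and c2 = (i + 3 + j) + 2.\<close>
  obtain i j l where ijl: "c1 = i + 2" "c2 = i + j + 5" "L = i + j + l + 6"
  proof
    show "c1 = (c1 - 2) + 2" "c2 = (c1 - 2) + (c2 - c1 - 3) + 5"
      "L = (c1 - 2) + (c2 - c1 - 3) + (L - c2 - 1) + 6" using c by linarith+
  qed
  \<comment> \<open>\<open>a1\<close> to \<open>a5\<close> are the distances from the vertices of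
    \<open>S\<close> to the terminals after each piece. \<open>f5\<close> back to \<open>f1\<close>
    are the surpluses that must be left at these stages, computed from the cap inwards.\<close>
  define a1 where "a1 = a + i"
  define a2 where "a2 = a1 + 3"
  define a3 where "a3 = a2 + j"
  define a4 where "a4 = a3 + 3"
  define a5 where "a5 = a4 + l"
  note as = a1_def a2_def a3_def a4_def a5_def
  define f5 where "f5 = 6 * a5 + 10 + d"
  define f4 where "f4 = f5 + l * (2 * a4 + 1 + l)"
  define f3 where "f3 = f4 + (8 * a3 + 16)"
  define f2 where "f2 = f3 + j * (2 * a2 + 1 + j)"
  define f1 where "f1 = f2 + (8 * a1 + 16)"
  have "f = f1 + i * (2 * a + 1 + i)"
    unfolding f f1_def f2_def f3_def f4_def f5_def as ijl by (simp add: algebra_simps)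
  with G obtain R1 s1 t1 where "gadget (n + 2 * i) R1 s1 t1 S a1 f1"
    using gadget_rungs[of n R s t S a f1 i] unfolding as by auto
  then obtain R2 s2 t2 where "gadget (n + 2 * i + 8) R2 s2 t2 S a2 f2"
    using gadget_bulge[of "n + 2 * i" R1 s1 t1 S a1 f2] unfolding f1_def a2_def by auto
  then obtain R3 s3 t3 where "gadget (n + 2 * i + 8 + 2 * j) R3 s3 t3 S a3 f3"
    using gadget_rungs[of "n + 2 * i + 8" R2 s2 t2 S a2 f3 j] unfolding f2_def a3_def by auto
  then obtain R4 s4 t4 where "gadget (n + 2 * i + 8 + 2 * j + 8) R4 s4 t4 S a4 f4"
    using gadget_bulge[of "n + 2 * i + 8 + 2 * j" R3 s3 t3 S a3 f4] unfolding f3_def a4_def by auto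
  then obtain R5 s5 t5 where "gadget (n + 2 * i + 8 + 2 * j + 8 + 2 * l) R5 s5 t5 S a5 f5"
    using gadget_rungs[of "n + 2 * i + 8 + 2 * j + 8" R4 s4 t4 S a4 f5 l] unfolding f4_def a5_def by auto
  with d have "\<exists>R'. solution (n + 2 * i + 8 + 2 * j + 8 + 2 * l + 6) R' S"
    unfolding f5_def by (elim disjE) (rule cap_even, simp, rule cap_odd, simp add: add.commute)
  moreover have "n \<le> n + 2 * i + 8 + 2 * j + 8 + 2 * l + 6" by simp
  ultimately show ?thesis by blast
qed

text \<open>Take the largest L whose cheapest tail fits. The next L would cost 2 * a + 2 * L + 8
  more, while moving the bulges outwards adds every even amount up to 2 * (2 * L - 12) and d
  supplies the parity. This closes the gap as soon as L is at least a + 15.\<close>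

lemma tail_parameters:
  fixes a f :: nat
  assumes f: "5 * (a + 30)\<^sup>2 \<le> f"
  shows "\<exists>L c1 c2 d. f = L * (2 * a) + L * (L + 1) + 10 * a + 6 * L + 10 + 2 * (c1 + c2) + d \<and>
    2 \<le> c1 \<and> c1 + 3 \<le> c2 \<and> c2 + 1 \<le> L \<and> (d = 0 \<or> d = (1::nat))"
proof -
  \<comment> \<open>The cost with both bulges as far in as possible, c1 = 2 and c2 = 5, and with d =
    0; thus 24 = 10 + 2 * 7.\<close>
  define b where "b L = L * (2 * a) + L * (L + 1) + 10 * a + 6 * L + 24" for L :: nat
  have step: "b (Suc L) = b L + 2 * a + 2 * L + 8" for L by (simp add: b_def algebra_simps)
  define m where "m = a + 15"
  \<comment> \<open>\<open>b m\<close> is 3 * a^2 + 77 * a + 354, far below this convenient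
    bound.\<close>
  have "b m \<le> 5 * (a + 30)\<^sup>2" by (simp add: b_def m_def power2_eq_square algebra_simps)
  then have "b m \<le> f" using f by simp
  have "L \<le> b L" for L by (simp add: b_def)
  then have bounded: "\<forall>L. b L \<le> f \<longrightarrow> L \<le> f" using le_trans by blast
  define L where "L = (GREATEST L. b L \<le> f)"
  have greatest: "K \<le> L" if "b K \<le> f" for K
    unfolding L_def using Greatest_le_nat[of "\<lambda>L. b L \<le> f" K f] that bounded by blast
  have L: "b L \<le> f" "m \<le> L" and nL: "\<not> b (Suc L) \<le> f"
  proof -
    show "b L \<le> f" unfolding L_def using GreatestI_nat[of "\<lambda>L. b L \<le> f" m f] \<open>b m \<le> f\<close> bounded by blast
    show "m \<le> L" using greatest \<open>b m \<le> f\<close> .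
    show "\<not> b (Suc L) \<le> f" using greatest[of "Suc L"] by linarith
  qed
  define g where "g = f - b L"
  define d where "d = g mod 2"
  define h where "h = g div 2"
  have g: "f = b L + g" "g < 2 * a + 2 * L + 8" "g = 2 * h + d" "d = 0 \<or> d = 1"
    using L nL step[of L] by (auto simp: g_def d_def h_def)
  have h: "h \<le> 2 * L - 12" using g(2,3) L(2) unfolding m_def by linarith
  \<comment> \<open>Move the outer bulge while there is room; then fix it at the last admissible
    depth L - 1 and move the inner one.\<close>
  have "\<exists>c1 c2. 2 \<le> c1 \<and> c1 + 3 \<le> c2 \<and> c2 + 1 \<le> L \<and> c1 + c2 = h + 7"
  proof (cases "h + 5 + 1 \<le> L")
    case True
    then show ?thesis by (intro exI[of _ 2] exI[of _ "h + 5"]) auto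
  next
    case False
    then show ?thesis using h L(2) unfolding m_def
      by (intro exI[of _ "h + 7 - (L - 1)"] exI[of _ "L - 1"]) linarith
  qed
  then obtain c1 c2 where c: "2 \<le> c1" "c1 + 3 \<le> c2" "c2 + 1 \<le> L" "c1 + c2 = h + 7" by blast
  have "f = L * (2 * a) + L * (L + 1) + 10 * a + 6 * L + 10 + 2 * (c1 + c2) + d"
    using g(1,3) unfolding c(4) b_def by simp
  then show ?thesis using c(1-3) g(4) by blast
qed

lemma solution_exists:
  assumes "gadget n R s t S a f" "5 * (a + 30)\<^sup>2 \<le> f"
  shows "\<exists>n' R'. n \<le> n' \<and> solution n' R' S"
  using tail_parameters[OF assms(2)] solution_tail[OF assms(1)] by metis

section \<open>Doubling\<close>

text \<open>An involutive automorphism fixing both terminals carries the graph without v to the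
  graph without \<open>\<sigma> v\<close>, so nothing has to be recomputed.\<close>

lemma excess_automorphism:
  assumes exc: "excess V R v s t a f"
    and R: "\<And>x y. (x, y) \<in> R \<Longrightarrow> (\<sigma> x, \<sigma> y) \<in> R" and inv: "\<And>x. \<sigma> (\<sigma> x) = x"
    and V: "\<And>x. x \<in> V \<Longrightarrow> \<sigma> x \<in> V" and st: "\<sigma> s = s" "\<sigma> t = t"
  shows "excess V R (\<sigma> v) s t a f"
proof -
  have d: "gdist R (\<sigma> x) (\<sigma> y) = gdist R x y" for x y
    by (rule gdist_automorphism[of R \<sigma> R, OF R R inv])
  have eq: "\<sigma> x = y \<longleftrightarrow> x = \<sigma> y" for x y using inv by metis
  have del: "(\<sigma> x, \<sigma> y) \<in> del R (\<sigma> u)" if "(x, y) \<in> del R u" for x y u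
    using that R eq inv unfolding del_def by auto
  have del': "(\<sigma> x, \<sigma> y) \<in> del R v" if "(x, y) \<in> del R (\<sigma> v)" for x y
    using del[OF that] inv by simp
  have d': "gdist (del R (\<sigma> v)) (\<sigma> x) (\<sigma> y) = gdist (del R v) x y" for x y
    by (rule gdist_automorphism[of "del R v" \<sigma> "del R (\<sigma> v)", OF del del' inv])
  have VV: "V - {\<sigma> v} = \<sigma> ` (V - {v})"
  proof
    show "V - {\<sigma> v} \<subseteq> \<sigma> ` (V - {v})"
    proof
      fix x assume "x \<in> V - {\<sigma> v}"
      then have "\<sigma> x \<in> V - {v}" using V inv by auto
      then show "x \<in> \<sigma> ` (V - {v})" using inv by (metis imageI)
    qed
    show "\<sigma> ` (V - {v}) \<subseteq> V - {\<sigma> v}" using V eq inv by auto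
  qed
  have W: "ordered_wiener (V - {\<sigma> v}) (del R (\<sigma> v)) = ordered_wiener (V - {v}) (del R v)"
    by (rule ordered_wiener_automorphism[of "del R v" \<sigma> "del R (\<sigma> v)", OF del del' inv VV])
  have keep: "gdist (del R (\<sigma> v)) y s = gdist R y s" "gdist (del R (\<sigma> v)) y t = gdist R y t"
    if "y \<in> V - {\<sigma> v}" for y
  proof -
    have "\<sigma> y \<in> V - {v}" using that V inv by auto
    then show "gdist (del R (\<sigma> v)) y s = gdist R y s" "gdist (del R (\<sigma> v)) y t = gdist R y t"
      using exc d'[of "\<sigma> y" s] d'[of "\<sigma> y" t] d[of "\<sigma> y" s] d[of "\<sigma> y" t] unfolding excess_def st inv
      by auto
  qed
  show ?thesis unfolding excess_def W
    using exc keep d[of v s] d[of v t] V st eq unfolding excess_def by auto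
qed

text \<open>Label \<open>x + 6\<close> stands for the second copy of the vertex \<open>x\<close>.\<close>

definition links :: "nat \<Rightarrow> nat \<Rightarrow> nat rel" where
  "links s t = {(0, 2), (1, 3), (s + 6, 2), (t + 6, 3), (2, 4), (3, 5), (4, 5),
    (2, 0), (3, 1), (2, s + 6), (3, t + 6), (4, 2), (5, 3), (5, 4)}"

lemma converse_insert: "(insert (x, y) A)\<inverse> = insert (y, x) (A\<inverse>)"
  by auto

lemma sym_links: "sym (links s t)"
proof -
  define L where "L = {(0, 2), (1, 3), (s + 6, 2), (t + 6, 3), (2, 4), (3, 5), (4, 5 :: nat)}"
  have "links s t = L\<inverse> \<union> L" by (simp add: links_def L_def converse_insert)
  then show ?thesis using sym_Un_converse[of L] by (simp add: Un_commute)
qed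

definition double :: "nat rel \<Rightarrow> nat \<Rightarrow> nat \<Rightarrow> nat rel" where
  "double R s t = links s t \<union> map_prod (\<lambda>x. x + 6) (\<lambda>x. x + 6) ` R"

lemma insert_Image: "insert (x, y) A `` {z} = (if z = x then insert y (A `` {z}) else A `` {z})"
  by auto

lemma label_cases:
  fixes i n :: nat
  assumes "i < n + 6"
  obtains "i = 0" | "i = 1" | "i = 2" | "i = 3" | "i = 4" | "i = 5" | x where "i = x + 6" "x < n"
proof -
  have "i = 0 \<or> i = 1 \<or> i = 2 \<or> i = 3 \<or> i = 4 \<or> i = 5 \<or> i = (i - 6) + 6 \<and> i - 6 < n"
    using assms by arith
  then show thesis using that by blast
qed

context numbered
begin

definition depth where "depth x = min (gdist R x s) (gdist R x t)"
text \<open>Labels 2 and 3 are junctions, each joined to the corresponding terminal of both copies;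
  4 and 5 are the new terminals. The second copy is entered through a junction, hence the offset
  2.\<close>

definition dlev where "dlev i = (if i < 2 then 0 else if i < 4 then 1 else if i < 6 then 2 else 2 + depth (i - 6))"
text \<open>From bottom to top: terminal 4, junction 2, the second copy in the interval from 2 to
  \<open>M\<close> + 2, the original gadget at \<open>M\<close> + 3, junction 3, terminal 5.\<close>

definition d\<mu> where "d\<mu> i = (if i < 2 then M + 3 else if i < 6 then [1, M + 4, 0, M + 5] ! (i - 2) else 2 + \<nu> (i - 6))"

lemma st_graph: "st_graph {..<n} R s t"
  unfolding st_graph_def using simple st lower higher by (auto intro!: exI[of _ \<nu>]; blast)

lemma double_copy: "(x + 6, y + 6) \<in> double R s t \<longleftrightarrow> (x, y) \<in> R"
  by (auto simp: double_def links_def)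

lemma double_links: "(i, j) \<in> links s t \<Longrightarrow> (i, j) \<in> double R s t"
  by (auto simp: double_def)

lemma doubleE:
  assumes "(i, j) \<in> double R s t"
  obtains "(i, j) \<in> links s t" | x y where "(x, y) \<in> R" "i = x + 6" "j = y + 6" "x < n" "y < n"
  using assms Rn that by (auto simp: double_def)

lemma reaches: "x < n \<Longrightarrow> y < n \<Longrightarrow> (x, y) \<in> R\<^sup>*"
  using st_graph_reaches[OF st_graph] by simp

lemma depth_step:
  assumes "(x, y) \<in> R"
  shows "depth x \<le> depth y + 1"
proof -
  have xy: "x < n" "y < n" using assms Rn by auto
  have "gdist R x z \<le> gdist R y z + 1" if "z < n" for z
    using gdist_triangle[of x y R z] gdist_edge[OF assms] reaches xy that by fastforce
  from this[of s] this[of t] st show ?thesis unfolding depth_def by linarith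
qed

text \<open>The first step of a shortest path to a nearest terminal.\<close>

lemma depth_down:
  assumes "x < n" "x \<noteq> s" "x \<noteq> t"
  shows "\<exists>y. (x, y) \<in> R \<and> depth y < depth x"
proof -
  obtain z where z: "z = s \<or> z = t" "depth x = gdist R x z" unfolding depth_def by (metis min_def)
  then have "(x, z) \<in> R ^^ depth x" "x \<noteq> z" using gdist_path[OF reaches, of x z] assms st by auto
  then obtain m where m: "depth x = Suc m" "(x, z) \<in> R ^^ Suc m" by (cases "depth x") auto
  then obtain y where "(x, y) \<in> R" "(y, z) \<in> R ^^ m" by (metis relpow_Suc_D2)
  moreover then have "depth y \<le> m" using z(1) gdist_le[of y z m R] unfolding depth_def by auto
  ultimately show ?thesis using m by auto
qed

text \<open>The second copy together with the four connecting vertices is treated as one pattern on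
  n + 4 new vertices, which makes doubling an instance of gluing.\<close>

lemma pattern_double: "pattern (n + 4) (double R s t) d\<mu> dlev (M + 3) 4 5"
proof
  show "sym (double R s t)"
    unfolding double_def using symR by (intro sym_Un sym_links) (auto simp: sym_def)
  show "irrefl (double R s t)"
    using irreflR by (auto simp: double_def links_def irrefl_def)
  show "double R s t \<subseteq> {..<n + 4 + 2} \<times> {..<n + 4 + 2}"
    using Rn st by (auto simp: double_def links_def)
  show "2 \<le> i \<or> 2 \<le> j" if "(i, j) \<in> double R s t" for i j
    using that by (auto simp: double_def links_def)
  show "(4, 5) \<in> double R s t" by (auto simp: double_def links_def)
  show "dlev i \<le> dlev j + 1" if "(i, j) \<in> double R s t" for i j
    using that depth_step by (auto elim!: doubleE simp: links_def dlev_def depth_def)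
  have im: "double R s t `` {i} = links s t `` {i}" if "i < 6" for i
    using that by (auto simp: double_def)
  show "card (double R s t `` {0}) = 1" "card (double R s t `` {1}) = 1"
    by (simp_all add: im) (simp_all add: links_def insert_Image)
  show "\<exists>j. (i, j) \<in> double R s t \<and> d\<mu> j < d\<mu> i" if "i < n + 4 + 2" "i \<noteq> 1" "i \<noteq> 4" for i
  proof -
    have "i < n + 6" using that by simp
    then show ?thesis
    proof (cases rule: label_cases)
      case (7 x)
      show ?thesis
      proof (cases "x = s")
        case False
        then obtain y where "(x, y) \<in> R" "\<nu> y < \<nu> x" using lower 7 by blast
        then show ?thesis using 7 by (intro exI[of _ "y + 6"]) (auto simp: double_copy d\<mu>_def)
      qed (use 7 in \<open>auto intro!: exI[of _ 2] double_links simp: links_def d\<mu>_def\<close>)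
    next
      case 1 then show ?thesis by (intro exI[of _ 2]) (auto intro!: double_links simp: links_def d\<mu>_def)
    next
      case 3 then show ?thesis by (intro exI[of _ 4]) (auto intro!: double_links simp: links_def d\<mu>_def)
    next
      case 4 then show ?thesis by (intro exI[of _ 1]) (auto intro!: double_links simp: links_def d\<mu>_def)
    next
      case 6 then show ?thesis by (intro exI[of _ 4]) (auto intro!: double_links simp: links_def d\<mu>_def)
    qed (use that in auto)
  qed
  show "\<exists>j. (i, j) \<in> double R s t \<and> d\<mu> i < d\<mu> j" if "i < n + 4 + 2" "i \<noteq> 0" "i \<noteq> 5" for i
  proof -
    have "i < n + 6" using that by simp
    then show ?thesis
    proof (cases rule: label_cases)
      case (7 x)
      show ?thesis
      proof (cases "x = t")
        case False
        then obtain y where "(x, y) \<in> R" "\<nu> x < \<nu> y" using higher 7 by blast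
        then show ?thesis using 7 by (intro exI[of _ "y + 6"]) (auto simp: double_copy d\<mu>_def)
      qed (use 7 bound[of t] in \<open>auto intro!: exI[of _ 3] double_links simp: links_def d\<mu>_def\<close>)
    next
      case 2 then show ?thesis by (intro exI[of _ 3]) (auto intro!: double_links simp: links_def d\<mu>_def)
    next
      case 3 then show ?thesis by (intro exI[of _ 0]) (auto intro!: double_links simp: links_def d\<mu>_def)
    next
      case 4 then show ?thesis by (intro exI[of _ 5]) (auto intro!: double_links simp: links_def d\<mu>_def)
    next
      case 5 then show ?thesis by (intro exI[of _ 5]) (auto intro!: double_links simp: links_def d\<mu>_def)
    qed (use that in auto)
  qed
  show "\<exists>j. (i, j) \<in> double R s t \<and> dlev j < dlev i" if "2 \<le> i" "i < n + 4 + 2" for i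
  proof -
    have "i < n + 6" using that by simp
    then show ?thesis
    proof (cases rule: label_cases)
      case (7 x)
      consider "x = s" | "x = t" | "x \<noteq> s" "x \<noteq> t" by blast
      then show ?thesis
      proof cases
        case 3
        then obtain y where "(x, y) \<in> R" "depth y < depth x" using depth_down 7 by blast
        then show ?thesis using 7 by (intro exI[of _ "y + 6"]) (auto simp: double_copy dlev_def)
      next
        case 1 then show ?thesis using 7 by (intro exI[of _ 2]) (auto intro!: double_links simp: links_def dlev_def)
      next
        case 2 then show ?thesis using 7 by (intro exI[of _ 3]) (auto intro!: double_links simp: links_def dlev_def)
      qed
    next
      case 3 then show ?thesis by (intro exI[of _ 0]) (auto intro!: double_links simp: links_def dlev_def)
    next
      case 4 then show ?thesis by (intro exI[of _ 1]) (auto intro!: double_links simp: links_def dlev_def)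
    next
      case 5 then show ?thesis by (intro exI[of _ 2]) (auto intro!: double_links simp: links_def dlev_def)
    next
      case 6 then show ?thesis by (intro exI[of _ 3]) (auto intro!: double_links simp: links_def dlev_def)
    qed (use that in auto)
  qed
  show "d\<mu> i \<noteq> M + 3" if "2 \<le> i" "i < n + 4 + 2" for i
  proof -
    have "i < n + 6" using that by simp
    then show ?thesis
    proof (cases rule: label_cases)
      case (7 x) then show ?thesis using bound[of x] by (simp add: d\<mu>_def)
    qed (use that in \<open>auto simp: d\<mu>_def\<close>)
  qed
qed (auto simp: d\<mu>_def dlev_def)

lemma double_deg:
  assumes "2 \<le> i" "i < n + 4 + 2"
  shows "card (double R s t `` {i}) = (if i = 4 \<or> i = 5 then 2 else 3)"
proof -
  have im: "double R s t `` {i} = links s t `` {i}" if "i < 6" for i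
    using that by (auto simp: double_def)
  have "i < n + 6" using assms by simp
  then show ?thesis
  proof (cases rule: label_cases)
    case (7 x)
    have *: "double R s t `` {x + 6} = links s t `` {x + 6} \<union> (\<lambda>y. y + 6) ` (R `` {x})"
      by (force simp: double_def)
    have "card ((\<lambda>y. y + 6) ` (R `` {x})) = card (R `` {x})" by (simp add: card_image)
    moreover have "links s t `` {x + 6} = (if x = s then {2} else if x = t then {3} else {})"
      using basic by (auto simp: links_def)
    moreover have "finite ((\<lambda>y. y + 6) ` (R `` {x}))" using finite_nbrs by simp
    ultimately show ?thesis using 7 deg[of x] basic unfolding 7(1) * by (auto simp: card_insert_if)
  qed (use assms in \<open>simp_all add: im\<close>, simp_all add: links_def insert_Image card_insert_if)
qed

section \<open>The involution exchanging the two copies\<close>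

definition swap where
  "swap x = (if x < n then x + (n + 4) else if n + 4 \<le> x \<and> x < 2 * n + 4 then x - (n + 4) else x)"

lemma swap_swap: "swap (swap x) = x"
  by (auto simp: swap_def)

definition copy where "copy = map_prod (\<lambda>x. x + (n + 4)) (\<lambda>x. x + (n + 4)) ` R"
definition spine where
  "spine = {(s, n), (t, n + 1), (s + (n + 4), n), (t + (n + 4), n + 1), (n, n + 2), (n + 1, n + 3),
    (n + 2, n + 3), (n, s), (n + 1, t), (n, s + (n + 4)), (n + 1, t + (n + 4)), (n + 2, n),
    (n + 3, n + 1), (n + 3, n + 2)}"

text \<open>Label x + 6 becomes the vertex n + (x + 6 - 2) = x + (n + 4), the offset used by
  \<open>swap\<close>. In this form the symmetry between \<open>R\<close> and \<open>copy\<close> is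
  visible.\<close>

lemma glue_double: "glue n R s t (double R s t) = R \<union> copy \<union> spine"
proof -
  have 1: "map_prod (place n s t) (place n s t) ` map_prod (\<lambda>x. x + 6) (\<lambda>x. x + 6) ` R = copy"
    unfolding image_image copy_def by (intro image_cong refl) (auto simp: place_def)
  have 2: "map_prod (place n s t) (place n s t) ` links s t = spine"
    by (simp add: links_def place_def spine_def ac_simps)
  show ?thesis unfolding glue_def double_def image_Un 1 2 by (simp only: Un_ac)
qed

lemma swap_edge:
  assumes "(x, y) \<in> glue n R s t (double R s t)"
  shows "(swap x, swap y) \<in> glue n R s t (double R s t)"
proof -
  have "(swap x, swap y) \<in> copy" if "(x, y) \<in> R"
    using that Rn by (auto simp: swap_def copy_def)
  moreover have "(swap x, swap y) \<in> R" if "(x, y) \<in> copy"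
    using that Rn by (auto simp: swap_def copy_def)
  moreover have "(swap x, swap y) \<in> spine" if "(x, y) \<in> spine"
    using that st unfolding spine_def by (elim insertE) (simp_all add: swap_def)
  ultimately show ?thesis using assms unfolding glue_double by blast
qed

end

text \<open>Gluing settles the vertices of \<open>S\<close>; their images under \<open>swap\<close>
  inherit the same a + 2 and f' because \<open>swap\<close> fixes the new terminals. One payment for
  the second copy thus serves both halves.\<close>

lemma gadget_double:
  assumes G: "gadget n R s t S a f" and S: "S \<noteq> {}" and f: "(2 * n + 4)\<^sup>2 \<le> f"
  shows "\<exists>R' s' t' S' f'. gadget (2 * n + 4) R' s' t' S' (a + 2) f' \<and> card S' = 2 * card S \<and>
    f \<le> f' + (2 * n + 4)\<^sup>2"
proof -
  obtain \<nu> M where "numbered n R s t \<nu> M" using gadget_numbering[OF G] .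
  then interpret numbered n R s t \<nu> M .
  interpret pattern "n + 4" "double R s t" d\<mu> dlev "M + 3" 4 5 by (rule pattern_double)
  have Sn: "S \<subseteq> {..<n}" and exc: "\<And>v. v \<in> S \<Longrightarrow> excess {..<n} R v s t a f"
    using G by (auto simp: gadget_def)
  have d: "gdist R x y < n" if "x < n" "y < n" for x y
    using gdist_bound[of "{..<n}" R x y] Rn reaches that by simp
  obtain v where "v \<in> S" using S by blast
  then have a: "a < n" using exc[of v] d[of v s] st unfolding excess_def by auto
  \<comment> \<open>Both a and all depths are below n, so each of the n + 4 new vertices costs at
    most (n - 1) + 2 + (n - 1).\<close>
  have "a + dlev i \<le> 2 * n" if i: "i < n + 6" for i
    using i
  proof (cases rule: label_cases)
    case (7 x)
    then have "depth x < n" using d[of x s] st by (simp add: depth_def)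
    then show ?thesis using 7 a by (simp add: dlev_def)
  qed (use a st in \<open>auto simp: dlev_def\<close>)
  then have "(\<Sum>i=2..<(n + 4) + 2. a + dlev i) \<le> card {2..<(n + 4) + 2} * (2 * n)"
    by (intro sum_bounded_above[where K = "2 * n", simplified]) simp_all
  also have "\<dots> \<le> (2 * n + 4)\<^sup>2" by (simp add: power2_eq_square algebra_simps)
  finally have sum: "(\<Sum>i=2..<(n + 4) + 2. a + dlev i) \<le> (2 * n + 4)\<^sup>2" .
  define f' where "f' = f - (\<Sum>i=2..<(n + 4) + 2. a + dlev i)"
  have f': "f = f' + (\<Sum>i=2..<(n + 4) + 2. a + dlev i)" using sum f by (simp add: f'_def)
  let ?R = "glue n R s t (double R s t)"
  have "gadget (n + (n + 4)) ?R (n + (4 - 2)) (n + (5 - 2)) S (a + 2) f'"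
    by (rule gadget_glue[OF G[unfolded f'] double_deg]) (simp_all add: dlev_def)
  moreover have "n + (n + 4) = 2 * n + 4" "n + (4 - 2) = n + 2" "n + (5 - 2) = n + 3" by simp_all
  ultimately have G': "gadget (2 * n + 4) ?R (n + 2) (n + 3) S (a + 2) f'" by (simp only:)
  have swap_exc: "excess {..<2 * n + 4} ?R (swap v) (n + 2) (n + 3) (a + 2) f'" if "v \<in> S" for v
    by (rule excess_automorphism[of _ _ _ _ _ _ _ swap, OF _ swap_edge swap_swap])
       (use G' that in \<open>auto simp: gadget_def swap_def\<close>)
  have "gadget (2 * n + 4) ?R (n + 2) (n + 3) (S \<union> swap ` S) (a + 2) f'"
    unfolding gadget_def
  proof (intro conjI)
    show "S \<union> swap ` S \<subseteq> {..<2 * n + 4}" using Sn by (auto simp: swap_def)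
    show "\<forall>v\<in>S \<union> swap ` S. excess {..<2 * n + 4} ?R v (n + 2) (n + 3) (a + 2) f'"
      using G' swap_exc unfolding gadget_def by blast
  qed (use G' in \<open>simp_all add: gadget_def\<close>)
  moreover have "card (S \<union> swap ` S) = 2 * card S"
  proof -
    have "S \<inter> swap ` S = {}" using Sn by (auto simp: swap_def)
    moreover have "inj_on swap S" by (metis inj_on_inverseI swap_swap)
    moreover have "finite S" using Sn finite_subset by blast
    ultimately show ?thesis by (simp add: card_Un_disjoint card_image)
  qed
  ultimately show ?thesis using sum f' by (metis add_left_mono)
qed

section \<open>The initial loop\<close>

text \<open>
  The starting gadget is a closed chain of layers of one or two vertices: \<open>0\<close> | \<open>1\<close> |
  \<open>N\<close> rungs | \<open>2N + 2\<close> | \<open>2N + 3\<close> | \<open>N + 1\<close> rungs | \<open>4N + 6\<close> | \<open>4N + 7\<close>.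
  The vertex \<open>2N + 3\<close> is opposite to the edge joining \<open>0\<close> and \<open>4N + 7\<close>, and deleting
  it turns a cycle into a path.
\<close>

definition arc :: "nat \<Rightarrow> nat \<Rightarrow> nat \<Rightarrow> bool" where
  "arc N x y \<longleftrightarrow>
     y = x + 1 \<and> y < 4 * N + 8 \<and> (even x \<or> x = 1 \<or> x = 2 * N + 1 \<or> x = 2 * N + 3 \<or> x = 4 * N + 5) \<or>
     y = x + 2 \<and> y < 4 * N + 8 \<and> x \<noteq> 0 \<and> x \<noteq> 2 * N + 1 \<and> x \<noteq> 2 * N + 2 \<and> x \<noteq> 4 * N + 5 \<or>
     x = 0 \<and> y = 4 * N + 7"

definition loop :: "nat \<Rightarrow> nat rel" where
  "loop N = {(x, y). arc N x y \<or> arc N y x}"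

text \<open>A rung consists of 2 * i and 2 * i + 1. The pairs starting at 0, 2 * N + 2 and 4 * N + 6
  occupy two layers each, which is why the offset to x div 2 grows along the chain.\<close>

definition layer :: "nat \<Rightarrow> nat \<Rightarrow> nat" where
  "layer N x = (if x \<le> 1 then x else if x \<le> 2 * N + 2 then x div 2 + 1
     else if x \<le> 4 * N + 6 then x div 2 + 2 else 2 * N + 6)"

lemma loop_subset: "loop N \<subseteq> {..<4 * N + 8} \<times> {..<4 * N + 8}"
  by (auto simp: loop_def arc_def)

lemma loop_simple: "simple_graph {..<4 * N + 8} (loop N)"
proof -
  have "sym (loop N)" by (auto simp: sym_def loop_def)
  moreover have "\<not> arc N x x" for x by (auto simp: arc_def)
  then have "irrefl (loop N)" by (simp add: irrefl_def loop_def)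
  ultimately show ?thesis using loop_subset by (simp add: simple_graph_def)
qed

text \<open>The cases isolate the single-vertex layers and the ends of the two ladders, where the
  offsets of the neighbours change; inside a ladder only the parity of x matters.\<close>

lemma loop_deg:
  assumes N: "N \<ge> 1" and x: "x < 4 * N + 8"
  shows "card (loop N `` {x}) = (if x = 0 \<or> x = 4 * N + 7 then 2 else 3)"
proof -
  have nbrs: "loop N `` {x} = {y. arc N x y \<or> arc N y x}" by (auto simp: loop_def)
  consider "x = 0" | "x = 1" | "x = 2" | "even x" "4 \<le> x" "x \<le> 2 * N" | "odd x" "3 \<le> x" "x < 2 * N + 1"
    | "x = 2 * N + 1" | "x = 2 * N + 2" | "x = 2 * N + 3" | "x = 2 * N + 4"
    | "even x" "2 * N + 6 \<le> x" "x \<le> 4 * N + 4" | "odd x" "2 * N + 5 \<le> x" "x < 4 * N + 5"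
    | "x = 4 * N + 5" | "x = 4 * N + 6" | "x = 4 * N + 7"
    using x by atomize_elim presburger
  then show ?thesis
  proof cases
    case 1
    with N have "arc N x y \<or> arc N y x \<longleftrightarrow> y \<in> {1, 4 * N + 7}" for y
      unfolding arc_def by (cases "y + 1 = x"; cases "y + 2 = x"; auto; presburger)
    then have "loop N `` {x} = {1, 4 * N + 7}" unfolding nbrs by blast
    then show ?thesis using 1 N by (auto simp: card_insert_if)
  next
    case 2
    with N have "arc N x y \<or> arc N y x \<longleftrightarrow> y \<in> {0, 2, 3}" for y
      unfolding arc_def by (cases "y + 1 = x"; cases "y + 2 = x"; auto; presburger)
    then have "loop N `` {x} = {0, 2, 3}" unfolding nbrs by blast
    then show ?thesis using 2 N by (auto simp: card_insert_if)
  next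
    case 3
    with N have "arc N x y \<or> arc N y x \<longleftrightarrow> y \<in> {1, 3, 4}" for y
      unfolding arc_def by (cases "y + 1 = x"; cases "y + 2 = x"; auto; presburger)
    then have "loop N `` {x} = {1, 3, 4}" unfolding nbrs by blast
    then show ?thesis using 3 N by (auto simp: card_insert_if)
  next
    case 4
    with N have "arc N x y \<or> arc N y x \<longleftrightarrow> y \<in> {x - 2, x + 1, x + 2}" for y
      unfolding arc_def by (cases "y + 1 = x"; cases "y + 2 = x"; auto; presburger)
    then have "loop N `` {x} = {x - 2, x + 1, x + 2}" unfolding nbrs by blast
    then show ?thesis using 4 N by (auto simp: card_insert_if)
  next
    case 5
    with N have "arc N x y \<or> arc N y x \<longleftrightarrow> y \<in> {x - 2, x - 1, x + 2}" for y
      unfolding arc_def by (cases "y + 1 = x"; cases "y + 2 = x"; auto; presburger)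
    then have "loop N `` {x} = {x - 2, x - 1, x + 2}" unfolding nbrs by blast
    then show ?thesis using 5 N by (auto simp: card_insert_if)
  next
    case 6
    with N have "arc N x y \<or> arc N y x \<longleftrightarrow> y \<in> {x - 2, x - 1, x + 1}" for y
      unfolding arc_def by (cases "y + 1 = x"; cases "y + 2 = x"; auto; presburger)
    then have "loop N `` {x} = {x - 2, x - 1, x + 1}" unfolding nbrs by blast
    then show ?thesis using 6 N by (auto simp: card_insert_if)
  next
    case 7
    with N have "arc N x y \<or> arc N y x \<longleftrightarrow> y \<in> {x - 2, x - 1, x + 1}" for y
      unfolding arc_def by (cases "y + 1 = x"; cases "y + 2 = x"; auto; presburger)
    then have "loop N `` {x} = {x - 2, x - 1, x + 1}" unfolding nbrs by blast
    then show ?thesis using 7 N by (auto simp: card_insert_if)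
  next
    case 8
    with N have "arc N x y \<or> arc N y x \<longleftrightarrow> y \<in> {x - 1, x + 1, x + 2}" for y
      unfolding arc_def by (cases "y + 1 = x"; cases "y + 2 = x"; auto; presburger)
    then have "loop N `` {x} = {x - 1, x + 1, x + 2}" unfolding nbrs by blast
    then show ?thesis using 8 N by (auto simp: card_insert_if)
  next
    case 9
    with N have "arc N x y \<or> arc N y x \<longleftrightarrow> y \<in> {x - 1, x + 1, x + 2}" for y
      unfolding arc_def by (cases "y + 1 = x"; cases "y + 2 = x"; auto; presburger)
    then have "loop N `` {x} = {x - 1, x + 1, x + 2}" unfolding nbrs by blast
    then show ?thesis using 9 N by (auto simp: card_insert_if)
  next
    case 10
    with N have "arc N x y \<or> arc N y x \<longleftrightarrow> y \<in> {x - 2, x + 1, x + 2}" for y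
      unfolding arc_def by (cases "y + 1 = x"; cases "y + 2 = x"; auto; presburger)
    then have "loop N `` {x} = {x - 2, x + 1, x + 2}" unfolding nbrs by blast
    then show ?thesis using 10 N by (auto simp: card_insert_if)
  next
    case 11
    with N have "arc N x y \<or> arc N y x \<longleftrightarrow> y \<in> {x - 2, x - 1, x + 2}" for y
      unfolding arc_def by (cases "y + 1 = x"; cases "y + 2 = x"; auto; presburger)
    then have "loop N `` {x} = {x - 2, x - 1, x + 2}" unfolding nbrs by blast
    then show ?thesis using 11 N by (auto simp: card_insert_if)
  next
    case 12
    with N have "arc N x y \<or> arc N y x \<longleftrightarrow> y \<in> {x - 2, x - 1, x + 1}" for y
      unfolding arc_def by (cases "y + 1 = x"; cases "y + 2 = x"; auto; presburger)
    then have "loop N `` {x} = {x - 2, x - 1, x + 1}" unfolding nbrs by blast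
    then show ?thesis using 12 N by (auto simp: card_insert_if)
  next
    case 13
    with N have "arc N x y \<or> arc N y x \<longleftrightarrow> y \<in> {x - 2, x - 1, x + 1}" for y
      unfolding arc_def by (cases "y + 1 = x"; cases "y + 2 = x"; auto; presburger)
    then have "loop N `` {x} = {x - 2, x - 1, x + 1}" unfolding nbrs by blast
    then show ?thesis using 13 N by (auto simp: card_insert_if)
  next
    case 14
    with N have "arc N x y \<or> arc N y x \<longleftrightarrow> y \<in> {0, x - 1}" for y
      unfolding arc_def by (cases "y + 1 = x"; cases "y + 2 = x"; auto; presburger)
    then have "loop N `` {x} = {0, x - 1}" unfolding nbrs by blast
    then show ?thesis using 14 N by (auto simp: card_insert_if)
  qed
qed

lemma loop_edge: "(x, y) \<in> loop N \<longleftrightarrow> arc N x y \<or> arc N y x"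
  by (simp add: loop_def)

lemma loop_lower:
  assumes N: "N \<ge> 1" and x: "x < 4 * N + 8" "x \<noteq> 0"
  shows "\<exists>y<4 * N + 8. (x, y) \<in> loop N \<and> layer N y + 1 = layer N x"
proof -
  consider "x = 1 \<or> x = 2 \<or> x = 2 * N + 3 \<or> x = 2 * N + 4 \<or> x = 4 * N + 7"
    | "x = 3 \<or> 4 \<le> x \<and> x \<le> 2 * N + 2 \<or> 2 * N + 5 \<le> x \<and> x \<le> 4 * N + 6"
    using x by atomize_elim presburger
  then show ?thesis
  proof cases
    case 1
    then have "arc N (x - 1) x" unfolding arc_def by auto
    moreover have "layer N (x - 1) + 1 = layer N x" using 1 N unfolding layer_def by auto
    ultimately show ?thesis using x by (intro exI[of _ "x - 1"]) (auto simp: loop_edge)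
  next
    case 2
    then have "arc N (x - 2) x" unfolding arc_def using N by auto
    moreover have "2 \<le> x" using 2 by auto
    then have "x div 2 = (x - 2) div 2 + 1" by (simp add: le_div_geq)
    then have "layer N (x - 2) + 1 = layer N x" using 2 N unfolding layer_def by auto
    ultimately show ?thesis using x by (intro exI[of _ "x - 2"]) (auto simp: loop_edge)
  qed
qed

lemma loop_higher:
  assumes N: "N \<ge> 1" and x: "x < 4 * N + 7"
  shows "\<exists>y<4 * N + 8. (x, y) \<in> loop N \<and> layer N x + 1 = layer N y"
proof -
  consider "x = 0 \<or> x = 1 \<or> x = 2 * N + 1 \<or> x = 2 * N + 2 \<or> x = 2 * N + 3 \<or> x = 4 * N + 5 \<or> x = 4 * N + 6"
    | "2 \<le> x \<and> x \<le> 2 * N \<or> 2 * N + 4 \<le> x \<and> x \<le> 4 * N + 4"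
    using x by atomize_elim presburger
  then show ?thesis
  proof cases
    case 1
    then have "arc N x (x + 1)" unfolding arc_def by auto
    moreover have "layer N x + 1 = layer N (x + 1)" using 1 N unfolding layer_def by auto
    ultimately show ?thesis using x by (intro exI[of _ "x + 1"]) (auto simp: loop_edge)
  next
    case 2
    then have "arc N x (x + 2)" unfolding arc_def using N by auto
    moreover have "layer N x + 1 = layer N (x + 2)" using 2 N unfolding layer_def by auto
    ultimately show ?thesis using x 2 by (intro exI[of _ "x + 2"]) (auto simp: loop_edge)
  qed
qed

lemma arc_layer:
  assumes "arc N x y" "N \<ge> 1"
  shows "layer N x \<le> layer N y + 1 \<and> layer N y \<le> layer N x + 1 \<or> x = 0 \<and> y = 4 * N + 7"
proof -
  consider "even x" "y = x + 1" | "x = 1 \<or> x = 2 * N + 1 \<or> x = 2 * N + 3 \<or> x = 4 * N + 5" "y = x + 1"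
    | "y = x + 2" "1 \<le> x" "y < 4 * N + 8" "x \<noteq> 2 * N + 1" "x \<noteq> 2 * N + 2" "x \<noteq> 4 * N + 5" | "x = 0 \<and> y = 4 * N + 7"
    using assms(1) unfolding arc_def by force
  then show ?thesis
  proof cases
    case 1
    then obtain m where "x = 2 * m" by (elim evenE)
    then show ?thesis using 1 assms(2) unfolding layer_def by auto
  qed (use assms(2) in \<open>auto simp: layer_def\<close>)
qed

lemma loop_layer:
  assumes "(x, y) \<in> loop N" "N \<ge> 1"
  shows "layer N x \<le> layer N y + 1 \<and> layer N y \<le> layer N x + 1 \<or>
    {layer N x, layer N y} = {0, 2 * N + 6}"
proof -
  have "layer N 0 = 0" "layer N (4 * N + 7) = 2 * N + 6" by (simp_all add: layer_def)
  then show ?thesis using assms arc_layer[of N x y] arc_layer[of N y x] by (auto simp: loop_edge)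
qed

lemma layer_bounds: "layer N x \<le> 2 * N + 6"
  unfolding layer_def by auto

lemma layer_eq:
  assumes "N \<ge> 1" "x < 4 * N + 8"
  shows "layer N x = 0 \<longleftrightarrow> x = 0" "layer N x = 2 * N + 6 \<longleftrightarrow> x = 4 * N + 7" "layer N x = N + 3 \<longleftrightarrow> x = 2 * N + 3"
proof -
  consider "x \<le> 1" | "2 \<le> x" "x \<le> 2 * N + 2" | "2 * N + 3 \<le> x" "x \<le> 4 * N + 6" | "x = 4 * N + 7"
    using assms(2) by linarith
  then have "(layer N x = 0 \<longleftrightarrow> x = 0) \<and> (layer N x = 2 * N + 6 \<longleftrightarrow> x = 4 * N + 7) \<and>
    (layer N x = N + 3 \<longleftrightarrow> x = 2 * N + 3)"
    by cases (use assms(1) in \<open>auto simp: layer_def\<close>)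
  then show "layer N x = 0 \<longleftrightarrow> x = 0" "layer N x = 2 * N + 6 \<longleftrightarrow> x = 4 * N + 7"
    "layer N x = N + 3 \<longleftrightarrow> x = 2 * N + 3" by auto
qed

text \<open>The layer number is itself an st-numbering: apart from the two ends, each vertex has
  neighbours in both adjacent layers.\<close>

lemma st_graph_loop:
  assumes N: "N \<ge> 1"
  shows "st_graph {..<4 * N + 8} (loop N) 0 (4 * N + 7)"
  unfolding st_graph_def
proof (intro conjI exI[of _ "layer N"] ballI loop_simple)
  show "\<exists>y. (x, y) \<in> loop N \<and> layer N y < layer N x" if "x \<in> {..<4 * N + 8} - {0}" for x
    using loop_lower[OF N, of x] that by force
  show "\<exists>y. (x, y) \<in> loop N \<and> layer N x < layer N y" if "x \<in> {..<4 * N + 8} - {4 * N + 7}" for x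
    using loop_higher[OF N, of x] that by force
qed (auto simp: loop_edge arc_def)

section \<open>Distances in the loop with and without v\<close>

locale long_loop =
  fixes N :: nat
  assumes N: "N \<ge> 1"
begin

abbreviation V where "V \<equiv> {..<4 * N + 8}"
abbreviation R where "R \<equiv> loop N"
abbreviation t where "t \<equiv> 4 * N + 7"
abbreviation v where "v \<equiv> 2 * N + 3"
abbreviation R' where "R' \<equiv> del R v"
abbreviation lay where "lay \<equiv> layer N"

lemma V: "x \<in> V \<Longrightarrow> y \<in> V \<Longrightarrow> (x, y) \<in> R\<^sup>*"
  using st_graph_reaches[OF st_graph_loop[OF N]] .

lemma V': "x \<in> V - {v} \<Longrightarrow> y \<in> V - {v} \<Longrightarrow> (x, y) \<in> R'\<^sup>*"
  using st_graph_del_reaches[OF st_graph_loop[OF N]] .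

lemma in_V: "0 \<in> V" "t \<in> V" "v \<in> V" "v \<noteq> 0" "v \<noteq> t" "t \<noteq> 0"
  using N by auto

lemma lay: "lay 0 = 0" "lay t = 2 * N + 6" "lay v = N + 3"
  using layer_eq[OF N] in_V by auto

lemma edge_V: "(x, y) \<in> R \<Longrightarrow> x \<in> V \<and> y \<in> V"
  using loop_subset by blast

lemma edge_0t: "(0, t) \<in> R" "(t, 0) \<in> R"
  by (auto simp: loop_edge arc_def)

text \<open>Distances to 0 and to t around the cycle of 2 * N + 7 layers. Past the middle layer N +
  3 the closing edge gives the shorter way to 0, and before it to t, so no shortest route has to
  cross v.\<close>

definition ds where "ds x = (if lay x \<le> N + 3 then lay x else 2 * N + 7 - lay x)"
definition dt where "dt x = (if lay x < N + 3 then lay x + 1 else 2 * N + 6 - lay x)"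

lemma ds_lipschitz: "(x, y) \<in> R \<Longrightarrow> ds x \<le> ds y + 1"
  using loop_layer[of x y N] N unfolding ds_def by (auto simp: doubleton_eq_iff)

lemma dt_lipschitz: "(x, y) \<in> R \<Longrightarrow> dt x \<le> dt y + 1"
  using loop_layer[of x y N] N unfolding dt_def by (auto simp: doubleton_eq_iff)

lemma edge_del: "(x, y) \<in> R \<Longrightarrow> x \<in> V - {v} \<Longrightarrow> lay y \<noteq> N + 3 \<Longrightarrow> (x, y) \<in> R' \<and> y \<in> V - {v}"
  using edge_V[of x y] lay(3) by (auto simp: del_def)

lemma lay_v: "x \<in> V \<Longrightarrow> lay x = N + 3 \<longleftrightarrow> x = v"
  using layer_eq(3)[OF N] by auto

lemma ds_descent:
  assumes x: "x \<in> V - {v}" "x \<noteq> 0"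
  shows "\<exists>y\<in>V - {v}. (x, y) \<in> R' \<and> ds y < ds x"
proof -
  have nv: "lay x \<noteq> N + 3" using lay_v[of x] x by auto
  consider "lay x < N + 3" | "N + 3 < lay x" "x \<noteq> t" | "x = t" using nv by linarith
  then show ?thesis
  proof cases
    case 1
    obtain y where y: "(x, y) \<in> R" "lay y + 1 = lay x" using loop_lower[OF N, of x] x by auto
    then show ?thesis using edge_del[OF y(1) x(1)] 1 by (intro bexI[of _ y]) (auto simp: ds_def)
  next
    case 2
    obtain y where y: "(x, y) \<in> R" "lay x + 1 = lay y" using loop_higher[OF N, of x] x 2 by auto
    then show ?thesis using edge_del[OF y(1) x(1)] 2 layer_bounds[of N y]
      by (intro bexI[of _ y]) (auto simp: ds_def)
  next
    case 3
    then show ?thesis using edge_del[OF edge_0t(2)] lay in_V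
      by (intro bexI[of _ 0]) (auto simp: ds_def)
  qed
qed

lemma dt_descent:
  assumes x: "x \<in> V - {v}" "x \<noteq> t"
  shows "\<exists>y\<in>V - {v}. (x, y) \<in> R' \<and> dt y < dt x"
proof -
  have nv: "lay x \<noteq> N + 3" using lay_v[of x] x by auto
  consider "lay x < N + 3" "x \<noteq> 0" | "N + 3 < lay x" | "x = 0" using nv by linarith
  then show ?thesis
  proof cases
    case 1
    obtain y where y: "(x, y) \<in> R" "lay y + 1 = lay x" using loop_lower[OF N, of x] x 1 by auto
    then show ?thesis using edge_del[OF y(1) x(1)] 1 by (intro bexI[of _ y]) (auto simp: dt_def)
  next
    case 2
    obtain y where y: "(x, y) \<in> R" "lay x + 1 = lay y" using loop_higher[OF N, of x] x by auto
    then show ?thesis using edge_del[OF y(1) x(1)] 2 layer_bounds[of N y]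
      by (intro bexI[of _ y]) (auto simp: dt_def)
  next
    case 3
    then show ?thesis using edge_del[OF edge_0t(1)] lay in_V
      by (intro bexI[of _ t]) (auto simp: dt_def)
  qed
qed

lemma ds: assumes "x \<in> V" shows "ds x \<le> gdist R x 0"
  using lipschitz_gdist[of R "\<lambda>x. int (ds x)" x 0] ds_lipschitz V[OF assms in_V(1)]
  by (force simp: ds_def lay)

lemma dt: assumes "x \<in> V" shows "dt x \<le> gdist R x t"
  using lipschitz_gdist[of R "\<lambda>x. int (dt x)" x t] dt_lipschitz V[OF assms in_V(2)]
  by (force simp: dt_def lay)

lemma ds': assumes "x \<in> V - {v}" shows "gdist R' x 0 \<le> ds x"
  using descent_gdist(2)[of "V - {v}" 0 R' ds x] ds_descent assms by blast

lemma dt': assumes "x \<in> V - {v}" shows "gdist R' x t \<le> dt x"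
  using descent_gdist(2)[of "V - {v}" t R' dt x] dt_descent assms by blast

lemma gdist_del_ge: "x \<in> V - {v} \<Longrightarrow> y \<in> V - {v} \<Longrightarrow> gdist R x y \<le> gdist R' x y"
  using gdist_antimono[OF del_subset V'] .

text \<open>The chain \<open>gdist R' x 0 \<le> ds x \<le> gdist R x 0 \<le> gdist R' x 0\<close>
  closes up: a descent avoiding v, a Lipschitz bound in the whole loop, and monotonicity. The same
  holds for t with \<open>dt\<close>.\<close>

lemma keep:
  assumes "x \<in> V - {v}"
  shows "gdist R' x 0 = gdist R x 0" "gdist R' x t = gdist R x t"
  using ds'[OF assms] dt'[OF assms] ds[of x] dt[of x] assms gdist_del_ge[OF assms, of 0]
    gdist_del_ge[OF assms, of t] in_V by auto

lemma v_below:
  assumes "x \<in> V" "lay x \<le> N + 3"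
  shows "gdist R x v \<le> N + 3 - lay x"
proof (rule descent_gdist(2)[of "{x \<in> V. lay x \<le> N + 3}" v R "\<lambda>x. N + 3 - lay x"])
  fix x assume x: "x \<in> {x \<in> V. lay x \<le> N + 3}" "x \<noteq> v"
  then have "lay x < N + 3" using lay_v[of x] by auto
  moreover then have "x \<noteq> t" using lay by auto
  then obtain y where "(x, y) \<in> R" "lay x + 1 = lay y" using loop_higher[OF N, of x] x by auto
  ultimately show "\<exists>y\<in>{x \<in> V. lay x \<le> N + 3}. (x, y) \<in> R \<and> N + 3 - lay y < N + 3 - lay x"
    using edge_V[of x y] by (intro bexI[of _ y]) auto
qed (use assms in auto)

lemma v_above:
  assumes "x \<in> V" "N + 3 \<le> lay x"
  shows "gdist R x v \<le> lay x - (N + 3)"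
proof (rule descent_gdist(2)[of "{x \<in> V. N + 3 \<le> lay x}" v R "\<lambda>x. lay x - (N + 3)"])
  fix x assume x: "x \<in> {x \<in> V. N + 3 \<le> lay x}" "x \<noteq> v"
  then have "N + 3 < lay x" using lay_v[of x] by auto
  moreover then have "x \<noteq> 0" using lay by (cases "x = 0") auto
  then obtain y where "(x, y) \<in> R" "lay y + 1 = lay x" using loop_lower[OF N, of x] x by auto
  ultimately show "\<exists>y\<in>{x \<in> V. N + 3 \<le> lay x}. (x, y) \<in> R \<and> lay y - (N + 3) < lay x - (N + 3)"
    using edge_V[of x y] by (intro bexI[of _ y]) auto
qed (use assms in auto)

lemma comm: "gdist R x y = gdist R y x"
  by (rule gdist_commute) (use loop_simple[of N] in \<open>simp add: simple_graph_def\<close>)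

lemma gdist_v: "gdist R v 0 = N + 3" "gdist R v t = N + 3"
proof -
  show "gdist R v 0 = N + 3"
    using ds[of v] v_below[of 0] in_V lay comm[of v 0] by (auto simp: ds_def)
  show "gdist R v t = N + 3"
    using dt[of v] v_above[of t] in_V lay comm[of v t] by (auto simp: dt_def)
qed

text \<open>Position along the path of layers left by the deletion of \<open>v\<close>.\<close>

definition pos :: "nat \<Rightarrow> int" where
  "pos x = (if lay x < N + 3 then int (lay x) else int (lay x) - int (2 * N + 7))"

lemma pos_lipschitz:
  assumes "(x, y) \<in> R'"
  shows "pos x \<le> pos y + 1"
proof -
  have "lay x \<noteq> N + 3" "lay y \<noteq> N + 3" "(x, y) \<in> R"
    using assms lay_v[of x] lay_v[of y] edge_V[of x y] by (auto simp: del_def)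
  then show ?thesis using loop_layer[of x y N] N unfolding pos_def by (auto simp: doubleton_eq_iff)
qed

text \<open>The route through v takes at most \<open>lay y - lay x\<close> steps. Once v is gone,
  the way leads over the closing edge and through the rest of the 2 * N + 7 layers.\<close>

lemma gap:
  assumes "x \<in> V" "lay x < N + 3" "y \<in> V" "N + 3 < lay y"
  shows "gdist R x y + (2 * N + 7) \<le> gdist R' x y + 2 * (lay y - lay x)"
proof -
  have nv: "x \<in> V - {v}" "y \<in> V - {v}" using assms lay by auto
  have "gdist R x y \<le> gdist R x v + gdist R v y"
    by (rule gdist_triangle) (use assms in_V V in auto)
  then have "gdist R x y \<le> lay y - lay x"
    using v_below[of x] v_above[of y] comm[of v y] assms by auto
  moreover have "pos x \<le> pos y + int (gdist R' x y)"
    by (rule lipschitz_gdist[OF pos_lipschitz V'[OF nv]])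
  then have "2 * N + 7 \<le> gdist R' x y + (lay y - lay x)"
    using assms unfolding pos_def by auto
  ultimately show ?thesis by simp
qed

text \<open>Take h vertices on each side of v, one per layer and within h layers of v. By
  \<open>gap\<close> each of the h^2 pairs gains at least 2 * N + 7 - 4 * h, hence at least 4 * h.
  The square on the right bounds the row and the column of v, which are lost.\<close>

lemma wiener_gain:
  assumes h: "N = 4 * h"
  shows "ordered_wiener V R + 4 * h ^ 3 \<le> ordered_wiener (V - {v}) R' + 2 * (4 * N + 8)\<^sup>2"
proof -
  let ?n = "4 * N + 8" and ?U = "V - {v}"
  \<comment> \<open>The even vertex of each of the h layers just before v; \<open>C\<close> does the
    same just after v.\<close>
  define A where "A = (\<lambda>i. 2 * N + 2 - 2 * i) ` {..<h}"
  define C where "C = (\<lambda>j. 2 * N + 4 + 2 * j) ` {..<h}"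
  have A: "x \<in> ?U \<and> lay x < N + 3 \<and> N + 3 \<le> lay x + h" if xA: "x \<in> A" for x
  proof -
    obtain i where i: "x = 2 * N + 2 - 2 * i" "i < h" using xA by (auto simp: A_def)
    then have "x = 2 * (N + 1 - i)" by simp
    then have "lay x = N + 2 - i" using i h N unfolding layer_def by auto
    then show ?thesis using i h by auto
  qed
  have C: "y \<in> ?U \<and> N + 3 < lay y \<and> lay y \<le> N + 3 + h" if yC: "y \<in> C" for y
  proof -
    obtain j where j: "y = 2 * (N + 2 + j)" "j < h" using yC by (auto simp: C_def)
    then have "lay y = N + 4 + j" using h N unfolding layer_def by auto
    then show ?thesis using j h by auto
  qed
  have "inj_on (\<lambda>i. 2 * N + 2 - 2 * i) {..<h}" using h by (auto simp: inj_on_def)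
  moreover have "inj_on (\<lambda>j. 2 * N + 4 + 2 * j) {..<h}" by (auto simp: inj_on_def)
  ultimately have card: "card A = h" "card C = h" by (simp_all add: A_def C_def card_image)
  have fin: "finite A" "finite C" by (simp_all add: A_def C_def)
  have pair: "gdist R x y + (if x \<in> A \<and> y \<in> C then 4 * h else 0) \<le> gdist R' x y"
    if xy: "x \<in> ?U" "y \<in> ?U" for x y
  proof (cases "x \<in> A \<and> y \<in> C")
    case True
    then have "gdist R x y + (2 * N + 7) \<le> gdist R' x y + 2 * (lay y - lay x)"
      using A[of x] C[of y] gap[of x y] by auto
    moreover have "lay y - lay x \<le> 2 * h" using A[of x] C[of y] True by auto
    ultimately show ?thesis using True h by auto
  qed (use gdist_del_ge[OF xy] in auto)
  have "(\<Sum>x\<in>?U. \<Sum>y\<in>?U. if x \<in> A \<and> y \<in> C then 4 * h else 0)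
      = (\<Sum>x\<in>A. \<Sum>y\<in>?U. if y \<in> C then 4 * h else 0)"
    by (rule sum.mono_neutral_cong_right) (use A in auto)
  also have "\<dots> = (\<Sum>x\<in>A. \<Sum>y\<in>C. 4 * h)"
    by (rule sum.cong[OF refl], rule sum.mono_neutral_cong_right) (use C in auto)
  also have "\<dots> = 4 * h ^ 3" by (simp add: card power3_eq_cube)
  finally have "(\<Sum>x\<in>?U. \<Sum>y\<in>?U. gdist R x y) + 4 * h ^ 3
      = (\<Sum>x\<in>?U. \<Sum>y\<in>?U. gdist R x y + (if x \<in> A \<and> y \<in> C then 4 * h else 0))"
    by (simp add: sum.distrib)
  also have "\<dots> \<le> ordered_wiener ?U R'"
    unfolding ordered_wiener_def by (intro sum_mono pair)
  finally have 1: "(\<Sum>x\<in>?U. \<Sum>y\<in>?U. gdist R x y) + 4 * h ^ 3 \<le> ordered_wiener ?U R'" .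
  have d: "gdist R x y \<le> ?n" if "x \<in> V" "y \<in> V" for x y
    using gdist_bound[OF _ loop_subset V[OF that] that(1)] by simp
  have finV: "finite V" by simp
  have "ordered_wiener V R = (\<Sum>y\<in>V. gdist R v y) + (\<Sum>x\<in>?U. \<Sum>y\<in>V. gdist R x y)"
    unfolding ordered_wiener_def by (rule sum.remove[OF finV in_V(3)])
  also have "(\<Sum>x\<in>?U. \<Sum>y\<in>V. gdist R x y) = (\<Sum>x\<in>?U. gdist R x v) + (\<Sum>x\<in>?U. \<Sum>y\<in>?U. gdist R x y)"
    by (simp only: sum.remove[OF finV in_V(3)] sum.distrib)
  also have "(\<Sum>x\<in>?U. gdist R x v) \<le> (\<Sum>x\<in>V. gdist R x v)"
    by (rule sum_mono2) auto
  also have "(\<Sum>x\<in>V. gdist R x v) \<le> card V * ?n"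
    by (rule sum_bounded_above[where K = ?n, simplified of_nat_id]) (use d in_V in auto)
  also have "(\<Sum>y\<in>V. gdist R v y) \<le> card V * ?n"
    by (rule sum_bounded_above[where K = ?n, simplified of_nat_id]) (use d in_V in auto)
  finally have "ordered_wiener V R \<le> 2 * ?n\<^sup>2 + (\<Sum>x\<in>?U. \<Sum>y\<in>?U. gdist R x y)"
    by (simp add: power2_eq_square)
  then show ?thesis using 1 by linarith
qed

end

section \<open>From the loop to infinitely many graphs\<close>

lemma base_gadget:
  "\<exists>n R s t S a f. gadget n R s t S a f \<and> card S = 1 \<and> K * n\<^sup>2 \<le> f \<and> K \<le> n"
proof -
  \<comment> \<open>With \<open>?n\<close> at most 24 * h, this h makes (K + 1) * 576 * h^2 equal to
    2 * h^3, half the ordered gain. One of the K + 1 squares pays for the lost distances to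
    v.\<close>
  define h where "h = 288 * (K + 1)"
  define N where "N = 4 * h"
  have N: "N \<ge> 1" by (simp add: N_def h_def)
  interpret long_loop N by unfold_locales (rule N)
  let ?n = "4 * N + 8"
  have sg: "simple_graph V R" "simple_graph (V - {v}) R'"
    by (rule loop_simple, rule simple_graph_del[OF loop_simple])
  define w where "w = ordered_wiener V R div 2"
  define w' where "w' = ordered_wiener (V - {v}) R' div 2"
  have w: "ordered_wiener V R = 2 * w" "ordered_wiener (V - {v}) R' = 2 * w'"
    using ordered_wiener_unordered[of V R] ordered_wiener_unordered[of "V - {v}" R'] sg
    unfolding simple_graph_def w_def w'_def by simp_all
  have "?n \<le> 24 * h" by (simp add: N_def h_def)
  then have n2: "?n\<^sup>2 \<le> 576 * h\<^sup>2" using power_mono[of ?n "24 * h" 2] by (simp add: power_mult_distrib)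
  have "w + 2 * h ^ 3 \<le> w' + ?n\<^sup>2" using wiener_gain[OF N_def] w by simp
  moreover have "(K + 1) * ?n\<^sup>2 \<le> (K + 1) * (576 * h\<^sup>2)" by (rule mult_le_mono2[OF n2])
  then have "(K + 1) * ?n\<^sup>2 \<le> 2 * h ^ 3"
    by (simp add: h_def power2_eq_square power3_eq_cube algebra_simps)
  ultimately have gain: "w + K * ?n\<^sup>2 \<le> w'" by simp
  have "gadget ?n R 0 t {v} (N + 3) (w' - w)"
    unfolding gadget_def excess_def
    using st_graph_loop[OF N] loop_deg[OF N] in_V gdist_v keep gain w by auto
  moreover have "K * ?n\<^sup>2 \<le> w' - w" using gain by simp
  moreover have "K \<le> ?n" by (simp add: N_def h_def)
  ultimately show ?thesis by (intro exI[of _ ?n] exI conjI) (assumption | simp)+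
qed

text \<open>K stays arbitrary in the induction because the gadget before a doubling needs a larger K
  than the one after it. The bound on n keeps n positive and later makes the graphs arbitrarily
  large.\<close>

lemma doubled_gadget:
  "\<exists>n R s t S a f. gadget n R s t S a f \<and> card S = 2 ^ r \<and> K * n\<^sup>2 \<le> f \<and> K \<le> n"
proof (induction r arbitrary: K)
  case 0
  then show ?case using base_gadget[of K] by simp
next
  case (Suc r)
  \<comment> \<open>The factor 36 comes from 2 * n + 4 <= 6 * n, and the summand 1 from the square
    spent on the doubling itself.\<close>
  define K' where "K' = 36 * (K + 1)"
  obtain n R s t S a f where G: "gadget n R s t S a f" "card S = 2 ^ r" "K' * n\<^sup>2 \<le> f" "K' \<le> n"
    using Suc by metis
  have "2 * n + 4 \<le> 6 * n" using G(4) by (simp add: K'_def)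
  then have n: "(2 * n + 4)\<^sup>2 \<le> 36 * n\<^sup>2"
    using power_mono[of "2 * n + 4" "6 * n" 2] by (simp add: power_mult_distrib)
  have Kn: "K * (2 * n + 4)\<^sup>2 + (2 * n + 4)\<^sup>2 \<le> K' * n\<^sup>2"
    using mult_le_mono2[OF n, of "K + 1"] by (simp add: K'_def algebra_simps)
  then have "(2 * n + 4)\<^sup>2 \<le> f" using G(3) by simp
  moreover have "S \<noteq> {}" using G(2) by auto
  ultimately obtain R' s' t' S' f' where "gadget (2 * n + 4) R' s' t' S' (a + 2) f'"
    "card S' = 2 * card S" "f \<le> f' + (2 * n + 4)\<^sup>2"
    using gadget_double[OF G(1)] by blast
  moreover have "K * (2 * n + 4)\<^sup>2 \<le> f'" using calculation(3) Kn G(3) by linarith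
  moreover have "K \<le> 2 * n + 4" using G(4) by (simp add: K'_def)
  ultimately show ?case using G(2) by (intro exI[of _ "2 * n + 4"] exI conjI) (assumption | simp)+
qed

lemma large_solution: "\<exists>n R S. m \<le> n \<and> 2 < n \<and> solution n R S \<and> card S = 2 ^ r"
proof -
  \<comment> \<open>Here 4805 = 5 * 31^2: since a < n gives a + 30 <= 31 * n, the surplus reaches
    the threshold of \<open>solution_exists\<close>. The summand m forces the order to be at least
    m.\<close>
  obtain n R s t S a f where G: "gadget n R s t S a f" "card S = 2 ^ r"
      "(m + 4805) * n\<^sup>2 \<le> f" "m + 4805 \<le> n"
    using doubled_gadget[of r "m + 4805"] by blast
  obtain v where v: "v \<in> S" using G(2) by fastforce
  then have st: "st_graph {..<n} R s t" and exc: "excess {..<n} R v s t a f"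
    using G(1) by (auto simp: gadget_def)
  then have "a = gdist R v s" "v < n" "s < n" "R \<subseteq> {..<n} \<times> {..<n}"
    by (auto simp: excess_def st_graph_def simple_graph_def)
  then have "a < n" using gdist_bound[of "{..<n}" R v s] st_graph_reaches[OF st, of v s] by simp
  then have "a + 30 \<le> 31 * n" using G(4) by linarith
  then have "5 * (a + 30)\<^sup>2 \<le> 4805 * n\<^sup>2"
    using power_mono[of "a + 30" "31 * n" 2] by (simp add: power_mult_distrib)
  also have "\<dots> \<le> f" using G(3) by (simp add: algebra_simps)
  finally obtain n' R' where "n \<le> n'" "solution n' R' S" using solution_exists[OF G(1)] by blast
  then show ?thesis using G(2,4) by (intro exI[of _ n'] exI[of _ R'] exI[of _ S]) auto
qed

lemma solution_graph:
  assumes "solution n R S" "2 < n"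
  defines "G \<equiv> to_graph {..<n} R"
  shows "pair_graph G" "cubic (with_proj G)" "vertex_connected 2 (with_proj G)"
    "card S \<le> card {v. soltes_vertex (with_proj G) v}" "card (pverts G) = n"
proof -
  obtain s t where st: "st_graph {..<n} R s t" and R: "\<And>x. x < n \<Longrightarrow> card (R `` {x}) = 3" "S \<subseteq> {..<n}"
    "\<And>v. v \<in> S \<Longrightarrow> ordered_wiener ({..<n} - {v}) (del R v) = ordered_wiener {..<n} R"
    using assms(1) by (auto simp: solution_def)
  have card: "2 < card {..<n}" using assms(2) by simp
  show "pair_graph G" using st pair_graph_to_graph unfolding st_graph_def G_def by blast
  show "cubic (with_proj G)" using R(1) by (simp add: G_def cubic_to_graph)
  show "vertex_connected 2 (with_proj G)"
    unfolding G_def using st_graph_vertex_connected[OF st card] .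
  have "S \<subseteq> {v. soltes_vertex (with_proj G) v}"
    unfolding G_def using soltes_to_graph[OF st card] R(2,3) by blast
  moreover have "{v. soltes_vertex (with_proj G) v} \<subseteq> {..<n}"
    by (auto simp: soltes_vertex_def G_def)
  then have "finite {v. soltes_vertex (with_proj G) v}" using finite_subset by blast
  ultimately show "card S \<le> card {v. soltes_vertex (with_proj G) v}" by (rule card_mono[rotated])
  show "card (pverts G) = n" by (simp add: G_def)
qed

theorem theorem3p1:
  fixes r :: nat
  assumes "r \<ge> 1"
  shows "\<exists>\<G> :: nat pair_pre_digraph set.
    infinite \<G> \<and>
    (\<forall>G\<in>\<G>. \<forall>H\<in>\<G>. G \<noteq> H \<longrightarrow> \<not> digraph_iso (with_proj G) (with_proj H)) \<and>
    (\<forall>G\<in>\<G>. pair_graph G \<and> cubic (with_proj G) \<and> vertex_connected 2 (with_proj G) \<and>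
       card {v. soltes_vertex (with_proj G) v} \<ge> 2 ^ r)"
proof -
  define Q where "Q G \<longleftrightarrow> pair_graph G \<and> cubic (with_proj G) \<and> vertex_connected 2 (with_proj G) \<and>
       card {v. soltes_vertex (with_proj G) v} \<ge> 2 ^ r" for G :: "nat pair_pre_digraph"
  \<comment> \<open>Isomorphic graphs have equal order, so choosing one graph for each order that
    occurs gives pairwise non-isomorphic graphs, infinitely many as the orders are
    unbounded.\<close>
  define orders where "orders = {n. \<exists>G. Q G \<and> card (pverts G) = n}"
  have "\<exists>n\<ge>m. n \<in> orders" for m
  proof -
    obtain n R S where S: "m \<le> n" "2 < n" "solution n R S" "card S = 2 ^ r"
      using large_solution by blast
    have "Q (to_graph {..<n} R)"
      unfolding Q_def using solution_graph(1-4)[OF S(3,2)] S(4) by simp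
    then show ?thesis using S(1) solution_graph(5)[OF S(3,2)] unfolding orders_def by blast
  qed
  then have "infinite orders" unfolding infinite_nat_iff_unbounded_le by blast
  define pick where "pick n = (SOME G. Q G \<and> card (pverts G) = n)" for n
  have pick: "Q (pick n) \<and> card (pverts (pick n)) = n" if "n \<in> orders" for n
    unfolding pick_def by (rule someI_ex) (use that in \<open>simp add: orders_def\<close>)
  have "inj_on pick orders" by (rule inj_on_inverseI[of _ "\<lambda>G. card (pverts G)"]) (simp add: pick)
  then have "infinite (pick ` orders)" using \<open>infinite orders\<close> by (simp add: finite_image_iff)
  moreover have "\<not> digraph_iso (with_proj G) (with_proj H)"
    if "G \<in> pick ` orders" "H \<in> pick ` orders" "G \<noteq> H" for G H
    using that pick digraph_iso_card[of "with_proj G" "with_proj H"] by auto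
  ultimately show ?thesis using pick unfolding Q_def by (intro exI[of _ "pick ` orders"]) blast
qed

end
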